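(* Let $m\ge0$, let $\Gamma^m=\bigcup_{i=1}^{I_S}\Gamma^m_i$ be a polyhedral surface cluster in $\mathbb{R}^d$, $d\in\{2,3\}$, and let $S^m$, $V^h(\Gamma^m)$, $\underline V^h(\Gamma^m)$ be the finite element spaces described in the context. Fix one of the two variants of the scheme (the superscript $\cdot^{(h)}$ means throughout mass lumping, or throughout exact integration). Let $(W^{m+1},\vec X^{m+1},\kappa_\varsigma^{m+1})\in S^m\times\underline V^h(\Gamma^m)\times V^h(\Gamma^m)$ satisfy: (a) for all $\varphi\in S^m$, $$\langle\nabla W^{m+1},\nabla\varphi\rangle_\Omega+\sum_{i=1}^{I_S}(\beta_{b_i^+}-\beta_{b_i^-})\Big\langle\pi^h_i\Big[\tfrac{\vec X^{m+1}_i-\vec{\rm id}}{\tau_m}\cdot\vec\omega^m_i\Big],\varphi\Big\rangle^{(h)}_{\Gamma^m_i}=0;$$ (b) for all $\xi\in V^h(\Gamma^m)$, $$\langle\kappa_\varsigma^{m+1},\xi\rangle^h_{\Gamma^m}+\sum_{i=1}^{I_S}(\beta_{b_i^+}-\beta_{b_i^-})\langle W^{m+1},\xi_i\rangle^{(h)}_{\Gamma^m_i}=0;$$ (c) for all $\vec\eta\in\underline V^h(\Gamma^m)$, $$\langle\kappa_\varsigma^{m+1}\vec\omega^m,\vec\eta\rangle^h_{\Gamma^m}+\sum_{i=1}^{I_S}\varsigma_i\int_{\Gamma^m_i}\nabla_\Gamma\vec X^{m+1}_i\cdot\nabla_\Gamma\vec\eta_i\,{\rm d}\mathscr H^{d-1}=0.$$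 Set $\Gamma^{m+1}=\vec X^{m+1}(\Gamma^m)$. Then $$E(\Gamma^{m+1})+\tau_m\|\nabla W^{m+1}\|_{L^2(\Omega)}^2\le E(\Gamma^m).$$
   Context: Data. $\Omega\subset\mathbb{R}^d$, $d\in\{2,3\}$, is a bounded domain whose closure is triangulated by a finite family $\mathscr T^m$ of simplices. $I_R\ge2$ is the number of phases, $I_S\ge1$ the number of surfaces, $I_T\ge0$ the number of triple junctions. $\varsigma_i>0$ ($1\le i\le I_S$) are surface tensions. $\beta_\ell\in\mathbb R$ ($1\le \ell\le I_R$) are pairwise distinct constants, normalized by $\sum_\ell\beta_\ell=0$. For each $i$, $(b_i^+,b_i^-)\in\{1,\dots,I_R\}^2$ with $b_i^+\ne b_i^-$ is the pair of phases separated by the $i$-th surface, the normal pointing from phase $b_i^-$ into phase $b_i^+$; if $\{b_i^+,b_i^-\}=\{b_j^+,b_j^-\}$ then $(b_i^+,b_i^-)=(b_j^+,b_j^-)$. $0=t_0<t_1<\dots<t_M=T$ and $\tau_m=t_{m+1}-t_m>0$. Polyhedral cluster. Each $\Gamma^m_i\subset\overline\Omega$ is a polyhedral hypersurface (a polygonal curve if $d=2$), with or without boundary, $\Gamma^m_i=\bigcup_{j=1}^{J_i}\overline{\sigma^m_{i,j}}$, where $\sigma^m_{i,j}$ are mutually disjoint open nondegenerate $(d-1)$-simplices, and with vertices $\vec q^m_{i,k}$, $k=1,\dots,K_i$. The boundary $\partial\Gamma^m_i$ is split into patches, each belonging to a triple junction. For each $k\in\{1,\dots,I_T\}$ there are indices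 $1\le s^k_1<s^k_2<s^k_3\le I_S$ such that one boundary patch of each of $\Gamma^m_{s^k_1},\Gamma^m_{s^k_2},\Gamma^m_{s^k_3}$ coincides (with matching vertices) with the discrete triple junction $\mathcal T^m_k$. (The cluster is the image of fixed polyhedral reference surfaces under a continuous piecewise affine map satisfying these matching conditions.) Energy. $E(\Gamma^m)=\sum_{i=1}^{I_S}\varsigma_i|\Gamma^m_i|$, where $|\Gamma^m_i|=\sum_{j}\mathscr H^{d-1}(\sigma^m_{i,j})$; likewise $E(\Gamma^{m+1})=\sum_i\varsigma_i|\Gamma^{m+1}_i|$ with $\Gamma^{m+1}_i=\vec X^{m+1}_i(\Gamma^m_i)$ made up of the simplices $\vec X^{m+1}_i(\sigma^m_{i,j})$. Finite element spaces. $S^m=\{v\in C(\overline\Omega): v|_o \text{ is affine for all } o\in\mathscr T^m\}$. $V^h(\Gamma^m_i)=\{v\in C(\Gamma^m_i): v|_{\sigma^m_{i,j}}\text{ is affine for all }j\}$, $\underline V^h(\Gamma^m_i)=[V^h(\Gamma^m_i)]^d$. $V^h(\Gamma^m)=\prod_{i=1}^{I_S}V^h(\Gamma^m_i)$. $\underline V^h(\Gamma^m)=\{(\vec X_1,\dots,\vec X_{I_S})\in\prod_{i}\underline V^h(\Gamma^m_i):\vec X_{s^k_1}=\vec X_{s^k_2}=\vec X_{s^k_3}\text{ on }\mathcal T^m_k,\ 1\le k\le I_T\}$. $\pi^h_i:C(\Gamma^m_i)\to V^h(\Gamma^m_i)$ is the standard nodal interpolation operator. $\vec{\rm id}$ is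 the identity map. Inner products. $\langle u,v\rangle_\Omega=\int_\Omega u\cdot v\,{\rm d}\mathscr L^d$; $\langle u,v\rangle_{\Gamma^m_i}=\int_{\Gamma^m_i}u\,v\,{\rm d}\mathscr H^{d-1}$. The mass lumped product of piecewise continuous $u,v$ is $$\langle u,v\rangle^h_{\Gamma^m_i}=\frac1d\sum_{j=1}^{J_i}|\sigma^m_{i,j}|\sum_{k=1}^d\lim_{\sigma^m_{i,j}\ni\vec q\to\vec q^m_{i,j,k}}(uv)(\vec q),$$ where $\vec q^m_{i,j,1},\dots,\vec q^m_{i,j,d}$ are the vertices of $\sigma^m_{i,j}$ and $|\sigma^m_{i,j}|=\mathscr H^{d-1}(\sigma^m_{i,j})$; $\langle u,v\rangle^{h}_{\Gamma^m}=\sum_i\langle u_i,v_i\rangle^{h}_{\Gamma^m_i}$. Products of vector- or matrix-valued functions use the Euclidean/Frobenius product. The notation $\langle\cdot,\cdot\rangle^{(h)}$ stands either everywhere for $\langle\cdot,\cdot\rangle^h$ or everywhere for the exact product $\langle\cdot,\cdot\rangle$, giving two schemes. $\nabla_\Gamma$ is the (piecewise) surface gradient. Normals. The vertices of all $\sigma^m_{i,j}$, $1\le j\le J_i$, are ordered with the same orientation. $\vec\nu^m_i$ is the piecewise constant unit normal equal on $\sigma^m_{i,j}$ to $\vec A\{\sigma^m_{i,j}\}/|\vec A\{\sigma^m_{i,j}\}|$, where $\vec A\{\sigma^m_{i,j}\}=(\vec q^m_{i,j,2}-\vec q^m_{i,j,1})^\perp$ if $d=2$, with $(v_1,v_2)^\perp=(-v_2,v_1)$,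 and $\vec A\{\sigma^m_{i,j}\}=(\vec q^m_{i,j,2}-\vec q^m_{i,j,1})\times(\vec q^m_{i,j,3}-\vec q^m_{i,j,1})$ if $d=3$. The vertex normal $\vec\omega^m_i\in\underline V^h(\Gamma^m_i)$ is defined by $\langle\vec\omega^m_i,\vec\xi\rangle^h_{\Gamma^m_i}=\langle\vec\nu^m_i,\vec\xi\rangle_{\Gamma^m_i}$ for all $\vec\xi\in\underline V^h(\Gamma^m_i)$, and $\vec\omega^m=(\vec\omega^m_1,\dots,\vec\omega^m_{I_S})$. *)

theory Defs
  imports "HOL-Analysis.Analysis"
begin

text \<open>Covering sets are required to be bounded because \<^const>\<open>diameter\<close> carries no
  information for unbounded sets. The definition is meant for \<open>k \<ge> 1\<close>, where empty covering sets
  contribute nothing (for \<open>k = 0\<close> the library convention \<open>0 ^ 0 = 1\<close> would count them).\<close>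

definition hausdorff_pre :: "nat \<Rightarrow> real \<Rightarrow> 'a::metric_space set \<Rightarrow> ennreal" where
  "hausdorff_pre k \<delta> A =
     (INF C \<in> {C :: nat \<Rightarrow> 'a set. A \<subseteq> (\<Union>n. C n) \<and> (\<forall>n. bounded (C n) \<and> diameter (C n) \<le> \<delta>)}.
        \<Sum>n. ennreal (unit_ball_vol (real k) * (diameter (C n) / 2) ^ k))"

definition hausdorff_outer :: "nat \<Rightarrow> 'a::metric_space set \<Rightarrow> ennreal" where
  "hausdorff_outer k A = (SUP \<delta> \<in> {0<..}. hausdorff_pre k \<delta> A)"

definition hausdorff_measure :: "nat \<Rightarrow> 'a::metric_space measure" where
  "hausdorff_measure k = measure_of UNIV (sets borel) (hausdorff_outer k)"

abbreviation surface_measure :: "(real ^ 'd) measure" where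
  "surface_measure \<equiv> hausdorff_measure (CARD('d) - 1)"

text \<open>A surface mesh is a finite set of ordered \<open>(d - 1)\<close>-simplices, each given by the list of its
  \<open>d\<close> vertices; the order of the list carries the orientation.\<close>

type_synonym 'a mesh = "'a list set"

definition open_simplex :: "'a::euclidean_space list \<Rightarrow> 'a set" where
  "open_simplex s = rel_interior (convex hull set s)"

definition mesh_vertices :: "'a mesh \<Rightarrow> 'a set" where
  "mesh_vertices M = (\<Union>s\<in>M. set s)"

definition mesh_carrier :: "'a::euclidean_space mesh \<Rightarrow> 'a set" where
  "mesh_carrier M = (\<Union>s\<in>M. closure (open_simplex s))"

text \<open>Two simplices sharing a \<open>(d - 2)\<close>-face have the same orientation iff they induce opposite
  orientations on that face. If \<open>v\<close> is the vertex of \<open>t\<close> opposite to the common face and \<open>s ! k\<close>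
  that of \<open>s\<close>, this says that \<open>t\<close> is an odd permutation of \<open>s[k := v]\<close>.\<close>

definition consistently_oriented :: "'a mesh \<Rightarrow> bool" where
  "consistently_oriented M \<longleftrightarrow>
     (\<forall>s\<in>M. \<forall>t\<in>M. \<forall>k<length s. \<forall>v p.
        v \<notin> set s \<and> p permutes {..<length s} \<and> t = permute_list p (s[k := v]) \<longrightarrow> sign p = -1)"

text \<open>The meshes are conforming (\<^const>\<open>triangulation\<close>: two closed simplices meet in a common face),
  which is what makes nodal interpolation well defined, and every \<open>(d - 2)\<close>-face, represented by its
  vertex set, belongs to at most two simplices.\<close>

definition polyhedral_hypersurface :: "(real ^ 'd) mesh \<Rightarrow> bool" where
  "polyhedral_hypersurface M \<longleftrightarrow>
     finite M \<and> M \<noteq> {} \<and>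
     (\<forall>s\<in>M. length s = CARD('d) \<and> distinct s \<and> \<not> affine_dependent (set s)) \<and>
     disjoint_family_on open_simplex M \<and>
     triangulation ((\<lambda>s. convex hull set s) ` M) \<and>
     (\<forall>F. card F = CARD('d) - 1 \<longrightarrow> card {s\<in>M. F \<subseteq> set s} \<le> 2) \<and>
     consistently_oriented M"

definition boundary_faces :: "(real ^ 'd) mesh \<Rightarrow> (real ^ 'd) set set" where
  "boundary_faces M = {F. card F = CARD('d) - 1 \<and> card {s\<in>M. F \<subseteq> set s} = 1}"

text \<open>\<open>J k\<close> is the set of \<open>(d - 2)\<close>-faces (as vertex sets) making up the \<open>k\<close>-th triple junction, and
  \<open>s k 1\<close>, \<open>s k 2\<close>, \<open>s k 3\<close> are the three surfaces meeting there. The patch of \<open>\<Gamma> i\<close> at this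
  junction is \<open>J k\<close> itself, so coincidence with matching vertices is equality of faces; the
  boundary of each surface is split into its patches.\<close>

definition junction_carrier :: "'a::euclidean_space set set \<Rightarrow> 'a set" where
  "junction_carrier F = (\<Union>f\<in>F. convex hull f)"

definition surface_cluster ::
  "nat \<Rightarrow> nat \<Rightarrow> (nat \<Rightarrow> nat \<Rightarrow> nat) \<Rightarrow> (nat \<Rightarrow> (real ^ 'd) set set) \<Rightarrow> (nat \<Rightarrow> (real ^ 'd) mesh) \<Rightarrow> bool"
  where
  "surface_cluster I_S I_T s J \<Gamma> \<longleftrightarrow>
     (\<forall>i\<in>{1..I_S}. polyhedral_hypersurface (\<Gamma> i)) \<and>
     (\<forall>k\<in>{1..I_T}. 1 \<le> s k 1 \<and> s k 1 < s k 2 \<and> s k 2 < s k 3 \<and> s k 3 \<le> I_S \<and>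
        J k \<noteq> {} \<and> (\<forall>l\<in>{1, 2, 3}. J k \<subseteq> boundary_faces (\<Gamma> (s k l)))) \<and>
     (\<forall>i\<in>{1..I_S}.
        boundary_faces (\<Gamma> i) = (\<Union>k\<in>{k\<in>{1..I_T}. i \<in> s k ` {1, 2, 3}}. J k) \<and>
        disjoint_family_on J {k\<in>{1..I_T}. i \<in> s k ` {1, 2, 3}})"

text \<open>Energy of the image of a cluster under \<open>X\<close>; the images of the simplices are counted with
  multiplicity.\<close>

definition cluster_energy ::
  "nat \<Rightarrow> (nat \<Rightarrow> real) \<Rightarrow> (nat \<Rightarrow> (real ^ 'd) mesh) \<Rightarrow> (nat \<Rightarrow> real ^ 'd \<Rightarrow> real ^ 'd) \<Rightarrow> real"
  where
  "cluster_energy I_S \<sigma> \<Gamma> X =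
     (\<Sum>i=1..I_S. \<sigma> i * (\<Sum>s\<in>\<Gamma> i. measure surface_measure (X i ` open_simplex s)))"

text \<open>Functions on a subset of space are total functions of which only the values on that subset
  matter.\<close>

definition affine_map_on :: "'a::real_vector set \<Rightarrow> ('a \<Rightarrow> 'b::real_vector) \<Rightarrow> bool" where
  "affine_map_on S f \<longleftrightarrow> (\<exists>L c. linear L \<and> (\<forall>x\<in>S. f x = L x + c))"

definition bulk_space :: "(real ^ 'd) set \<Rightarrow> (real ^ 'd) set set \<Rightarrow> (real ^ 'd \<Rightarrow> real) set" where
  "bulk_space \<Omega> \<T> = {v. continuous_on (closure \<Omega>) v \<and> (\<forall>K\<in>\<T>. affine_map_on K v)}"

definition surface_space :: "(real ^ 'd) mesh \<Rightarrow> (real ^ 'd \<Rightarrow> real) set" where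
  "surface_space M =
     {v. continuous_on (mesh_carrier M) v \<and> (\<forall>s\<in>M. affine_map_on (open_simplex s) v)}"

definition surface_vspace :: "(real ^ 'd) mesh \<Rightarrow> (real ^ 'd \<Rightarrow> real ^ 'd) set" where
  "surface_vspace M = {X. \<forall>c. (\<lambda>x. X x $ c) \<in> surface_space M}"

definition cluster_space ::
  "nat \<Rightarrow> (nat \<Rightarrow> (real ^ 'd) mesh) \<Rightarrow> (nat \<Rightarrow> real ^ 'd \<Rightarrow> real) set" where
  "cluster_space I_S \<Gamma> = {v. \<forall>i\<in>{1..I_S}. v i \<in> surface_space (\<Gamma> i)}"

definition cluster_vspace ::
  "nat \<Rightarrow> nat \<Rightarrow> (nat \<Rightarrow> nat \<Rightarrow> nat) \<Rightarrow> (nat \<Rightarrow> (real ^ 'd) set set) \<Rightarrow> (nat \<Rightarrow> (real ^ 'd) mesh)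
     \<Rightarrow> (nat \<Rightarrow> real ^ 'd \<Rightarrow> real ^ 'd) set" where
  "cluster_vspace I_S I_T s J \<Gamma> =
     {X. (\<forall>i\<in>{1..I_S}. X i \<in> surface_vspace (\<Gamma> i)) \<and>
         (\<forall>k\<in>{1..I_T}. \<forall>x\<in>junction_carrier (J k).
            X (s k 1) x = X (s k 2) x \<and> X (s k 2) x = X (s k 3) x)}"

text \<open>The interpolant is determined on \<^term>\<open>mesh_carrier M\<close>; its values elsewhere are arbitrary.\<close>

definition nodal_interp :: "(real ^ 'd) mesh \<Rightarrow> (real ^ 'd \<Rightarrow> real) \<Rightarrow> real ^ 'd \<Rightarrow> real" where
  "nodal_interp M f = (SOME v. v \<in> surface_space M \<and> (\<forall>q\<in>mesh_vertices M. v q = f q))"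

definition exact_prod ::
  "(real ^ 'd) mesh \<Rightarrow> (real ^ 'd \<Rightarrow> 'b::real_inner) \<Rightarrow> (real ^ 'd \<Rightarrow> 'b) \<Rightarrow> real" where
  "exact_prod M u v = (LINT x:mesh_carrier M|surface_measure. u x \<bullet> v x)"

definition lumped_prod ::
  "(real ^ 'd) mesh \<Rightarrow> (real ^ 'd \<Rightarrow> 'b::real_inner) \<Rightarrow> (real ^ 'd \<Rightarrow> 'b) \<Rightarrow> real" where
  "lumped_prod M u v =
     1 / real CARD('d) * (\<Sum>s\<in>M. measure surface_measure (open_simplex s) *
        (\<Sum>k<CARD('d). Lim (at (s ! k) within open_simplex s) (\<lambda>x. u x \<bullet> v x)))"

datatype quadrature = Lumped | Exact

fun quad_prod ::
  "quadrature \<Rightarrow> (real ^ 'd) mesh \<Rightarrow> (real ^ 'd \<Rightarrow> 'b::real_inner) \<Rightarrow> (real ^ 'd \<Rightarrow> 'b) \<Rightarrow> real" where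
  "quad_prod Lumped M u v = lumped_prod M u v"
| "quad_prod Exact M u v = exact_prod M u v"

definition grad :: "('a::euclidean_space \<Rightarrow> real) \<Rightarrow> 'a \<Rightarrow> 'a" where
  "grad f x = (if f differentiable (at x) then (THE g. GDERIV f x :> g) else 0)"

text \<open>Gradient along a relatively open piece \<open>S\<close> of an affine subspace: the unique vector in the
  direction space of \<open>S\<close> that represents the derivative within \<open>S\<close>.\<close>

definition tangential_grad :: "'a::euclidean_space set \<Rightarrow> ('a \<Rightarrow> real) \<Rightarrow> 'a \<Rightarrow> 'a" where
  "tangential_grad S f x =
     (THE g. g \<in> span {y - z | y z. y \<in> S \<and> z \<in> S} \<and>
             (f has_derivative (\<lambda>h. g \<bullet> h)) (at x within S))"

text \<open>Piecewise surface gradient of a vector field, as the matrix whose rows are the surface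
  gradients of the components; it is set to zero off the open simplices, a null set of the surface.
  The inner product of \<^typ>\<open>real ^ 'd ^ 'd\<close> is the Frobenius product.\<close>

definition surface_grad :: "(real ^ 'd) mesh \<Rightarrow> (real ^ 'd \<Rightarrow> real ^ 'd) \<Rightarrow> real ^ 'd \<Rightarrow> real ^ 'd ^ 'd" where
  "surface_grad M X x =
     (\<chi> c. \<Sum>s\<in>M. indicator (open_simplex s) x *\<^sub>R tangential_grad (open_simplex s) (\<lambda>y. X y $ c) x)"

text \<open>\<open>e\<close> enumerates the coordinates: \<open>x $ e k\<close> is the \<open>k\<close>-th Cartesian coordinate of \<open>x\<close>. The two
  cases are \<open>(v\<^sub>1, v\<^sub>2)\<close> turned into \<open>(-v\<^sub>2, v\<^sub>1)\<close>, and the cross product.\<close>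

definition area_vector :: "(nat \<Rightarrow> 'd) \<Rightarrow> (real ^ 'd) list \<Rightarrow> real ^ 'd" where
  "area_vector e s =
     (let u = s ! 1 - s ! 0; v = s ! 2 - s ! 0 in
      if CARD('d) = 2
      then (\<chi> c. if c = e 1 then - (u $ e 2) else u $ e 1)
      else (\<chi> c. if c = e 1 then u $ e 2 * v $ e 3 - u $ e 3 * v $ e 2
                 else if c = e 2 then u $ e 3 * v $ e 1 - u $ e 1 * v $ e 3
                 else u $ e 1 * v $ e 2 - u $ e 2 * v $ e 1))"

definition unit_normal :: "(nat \<Rightarrow> 'd) \<Rightarrow> (real ^ 'd) mesh \<Rightarrow> real ^ 'd \<Rightarrow> real ^ 'd" where
  "unit_normal e M x =
     (\<Sum>s\<in>M. indicator (open_simplex s) x *\<^sub>R (area_vector e s /\<^sub>R norm (area_vector e s)))"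

definition is_vertex_normal ::
  "(nat \<Rightarrow> 'd) \<Rightarrow> (real ^ 'd) mesh \<Rightarrow> (real ^ 'd \<Rightarrow> real ^ 'd) \<Rightarrow> bool" where
  "is_vertex_normal e M w \<longleftrightarrow>
     w \<in> surface_vspace M \<and>
     (\<forall>\<xi>\<in>surface_vspace M. lumped_prod M w \<xi> = exact_prod M (unit_normal e M) \<xi>)"

end

theory Submission
  imports Defs
begin

text \<open>Test (a) with \<open>W\<close>, (b) with the nodal interpolants of \<open>\<tau>\<^sup>-\<^sup>1 (X\<^sub>i - id) \<cdot> \<omega>\<^sub>i\<close> and (c) with
  \<open>X - id\<close>. Since a mass lumped product only sees vertex values, this gives
  \<open>\<tau> \<parallel>\<nabla>W\<parallel>\<^sup>2 + \<Sum>\<^sub>i \<sigma>\<^sub>i \<integral> \<nabla>X\<^sub>i \<cdot> \<nabla>(X\<^sub>i - id) = 0\<close>, and it remains to bound the change of area of each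
  simplex by the integral over it. There the surface gradients \<open>G\<close> of \<open>X\<close> and \<open>H\<close> of the identity are
  constant, \<open>\<bar>H\<bar>\<^sup>2 = d - 1\<close>, and the area changes by a factor \<open>\<bar>det N\<bar>\<close>, where \<open>N\<close> represents \<open>G\<close> in
  orthonormal bases of two \<open>(d - 1)\<close>-dimensional subspaces. As \<open>N\<close> has size 1 or 2,
  \<open>\<bar>det N\<bar> - 1 \<le> (\<bar>G\<bar>\<^sup>2 - (d - 1)) / 2 = (\<bar>G\<bar>\<^sup>2 - \<bar>H\<bar>\<^sup>2) / 2 \<le> G \<cdot> (G - H)\<close>.
  The area factor is obtained by comparing Hausdorff measure on a subspace with Lebesgue measure:
  both are translation invariant, hence proportional.\<close>

section \<open>Hausdorff measure on linear subspaces\<close>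

lemma hausdorff_pre_finite_cover:
  fixes A :: "'a::metric_space set"
  assumes I: "finite I" and cover: "A \<subseteq> (\<Union>i\<in>I. D i)"
    and D: "\<And>i. i \<in> I \<Longrightarrow> bounded (D i)" "\<And>i. i \<in> I \<Longrightarrow> diameter (D i) \<le> \<delta>"
    and k: "k \<ge> 1" and \<delta>: "\<delta> \<ge> 0"
  shows "hausdorff_pre k \<delta> A \<le> ennreal (real (card I) * (unit_ball_vol (real k) * (\<delta> / 2) ^ k))"
proof -
  obtain h where h: "bij_betw h {..<card I} I"
    using ex_bij_betw_nat_finite[OF I] by (auto simp: atLeast0LessThan)
  \<comment> \<open>The family is padded with empty sets to the sequence that
    \<open>hausdorff_pre\<close> asks for. They contribute nothing because \<open>k \<ge> 1\<close>
    makes \<open>0 ^ k\<close> vanish.\<close>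
  define C where "C n = (if n < card I then D (h n) else {})" for n
  have hI: "h n \<in> I" if "n < card I" for n
    using h that by (auto simp: bij_betw_def)
  have "A \<subseteq> (\<Union>n. C n)"
  proof
    fix x assume "x \<in> A"
    then obtain i where i: "i \<in> I" "x \<in> D i" using cover by auto
    then have "i \<in> h ` {..<card I}" using h by (simp add: bij_betw_def)
    then obtain n where "n < card I" "h n = i" by auto
    then show "x \<in> (\<Union>n. C n)" using i by (auto simp: C_def intro!: exI[of _ n])
  qed
  moreover have bC: "bounded (C n) \<and> diameter (C n) \<le> \<delta>" for n
    using D hI \<delta> by (auto simp: C_def)
  ultimately have "hausdorff_pre k \<delta> A \<le>
      (\<Sum>n. ennreal (unit_ball_vol (real k) * (diameter (C n) / 2) ^ k))"
    unfolding hausdorff_pre_def by (intro INF_lower) auto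
  also have "\<dots> = (\<Sum>n<card I. ennreal (unit_ball_vol (real k) * (diameter (C n) / 2) ^ k))"
    by (rule suminf_finite) (use k in \<open>auto simp: C_def\<close>)
  also have "\<dots> \<le> (\<Sum>n<card I. ennreal (unit_ball_vol (real k) * (\<delta> / 2) ^ k))"
    using bC diameter_ge_0
    by (intro sum_mono ennreal_leI mult_left_mono power_mono divide_right_mono) auto
  also have "\<dots> = ennreal (real (card I) * (unit_ball_vol (real k) * (\<delta> / 2) ^ k))"
    by (simp add: ennreal_mult' ennreal_of_nat_eq_real_of_nat)
  finally show ?thesis .
qed

text \<open>A cover of \<open>A\<close> is carried over to a cover of its image. Each covering set
  is first intersected with \<open>A\<close>, since \<open>f\<close> is controlled only
  there.\<close>

lemma hausdorff_pre_nonexpansive_image: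
  fixes f :: "'a::metric_space \<Rightarrow> 'b::metric_space"
  assumes f: "\<And>x y. x \<in> A \<Longrightarrow> y \<in> A \<Longrightarrow> dist (f x) (f y) \<le> dist x y"
  shows "hausdorff_pre k \<delta> (f ` A) \<le> hausdorff_pre k \<delta> A"
  unfolding hausdorff_pre_def
proof (rule INF_mono)
  fix C :: "nat \<Rightarrow> 'a set"
  assume C: "C \<in> {C. A \<subseteq> (\<Union>n. C n) \<and> (\<forall>n. bounded (C n) \<and> diameter (C n) \<le> \<delta>)}"
  define D where "D n = f ` (C n \<inter> A)" for n
  have D: "bounded (D n) \<and> 0 \<le> diameter (D n) \<and> diameter (D n) \<le> diameter (C n)" for n
  proof -
    have b: "bounded (C n)" using C by auto
    have le: "dist u v \<le> diameter (C n)" if uv: "u \<in> D n" "v \<in> D n" for u v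
    proof -
      obtain x y where "x \<in> C n \<inter> A" "y \<in> C n \<inter> A" "u = f x" "v = f y"
        using uv by (auto simp: D_def)
      then show ?thesis using f[of x y] diameter_bounded_bound[OF b, of x y] by auto
    qed
    have bD: "bounded (D n)"
      using le unfolding bounded_two_points by blast
    have "diameter (D n) \<le> diameter (C n)"
    proof (cases "D n = {}")
      case True
      then show ?thesis using diameter_ge_0[OF b] by simp
    next
      case False
      then show ?thesis unfolding diameter_def[of "D n"]
        by (auto intro!: cSUP_least le)
    qed
    then show ?thesis using bD diameter_ge_0 by blast
  qed
  show "\<exists>D\<in>{C. f ` A \<subseteq> (\<Union>n. C n) \<and> (\<forall>n. bounded (C n) \<and> diameter (C n) \<le> \<delta>)}.
      (\<Sum>n. ennreal (unit_ball_vol (real k) * (diameter (D n) / 2) ^ k))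
      \<le> (\<Sum>n. ennreal (unit_ball_vol (real k) * (diameter (C n) / 2) ^ k))"
  proof (rule bexI[of _ D])
    show "(\<Sum>n. ennreal (unit_ball_vol (real k) * (diameter (D n) / 2) ^ k))
      \<le> (\<Sum>n. ennreal (unit_ball_vol (real k) * (diameter (C n) / 2) ^ k))"
      using D by (intro suminf_le ennreal_leI mult_left_mono power_mono divide_right_mono) auto
    have "f ` A \<subseteq> (\<Union>n. D n)" using C unfolding D_def by blast
    moreover have "diameter (D n) \<le> \<delta>" for n using D[of n] C by (auto intro: order_trans)
    ultimately show "D \<in> {C. f ` A \<subseteq> (\<Union>n. C n) \<and> (\<forall>n. bounded (C n) \<and> diameter (C n) \<le> \<delta>)}"
      using D by auto
  qed
qed

lemma hausdorff_outer_nonexpansive_image: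
  assumes "\<And>x y. x \<in> A \<Longrightarrow> y \<in> A \<Longrightarrow> dist (f x) (f y) \<le> dist x y"
  shows "hausdorff_outer k (f ` A) \<le> hausdorff_outer k A"
  unfolding hausdorff_outer_def
  by (rule SUP_mono) (use hausdorff_pre_nonexpansive_image[of A f, OF assms] in blast)

text \<open>A grid of cubes with side \<open>1 / N\<close> has \<open>(N + 1) ^ k\<close> members,
  each of diameter at most \<open>k / N\<close> by the l1 bound. The resulting sum has a bound that
  depends neither on \<open>N\<close> nor on \<open>\<delta>\<close>.\<close>

lemma hausdorff_outer_unit_cube_finite:
  "hausdorff_outer CARD('k) {x :: real ^ 'k. \<forall>c. 0 \<le> x $ c \<and> x $ c \<le> 1} < \<infinity>"
proof -
  let ?Q = "{x :: real ^ 'k. \<forall>c. 0 \<le> x $ c \<and> x $ c \<le> 1}"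
  let ?k = "CARD('k)"
  define K where "K = unit_ball_vol (real ?k) * real ?k ^ ?k"
  have "hausdorff_pre ?k \<delta> ?Q \<le> ennreal K" if \<delta>: "\<delta> > 0" for \<delta>
  proof -
    obtain N :: nat where N: "N > 0" "real ?k / real N < \<delta>"
    proof -
      obtain n :: nat where "real ?k / \<delta> < real n" using reals_Archimedean2 by blast
      then have "real ?k / \<delta> < real (Suc n)" by simp
      then show ?thesis using \<delta> by (intro that[of "Suc n"]) (auto simp: field_simps)
    qed
    define D :: "('k \<Rightarrow> nat) \<Rightarrow> (real ^ 'k) set" where
      "D f = {x. \<forall>c. real (f c) / N \<le> x $ c \<and> x $ c \<le> (real (f c) + 1) / N}" for f
    \<comment> \<open>The index \<open>N\<close> is included because a coordinate equal to 1 has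
      floor \<open>N\<close> after scaling.\<close>
    define I where "I = (UNIV :: 'k set) \<rightarrow>\<^sub>E {..N}"
    have fin: "finite I" unfolding I_def by (intro finite_PiE) auto
    have card: "card I = (N + 1) ^ ?k" unfolding I_def by (simp add: card_PiE)
    have cover: "?Q \<subseteq> (\<Union>f\<in>I. D f)"
    proof
      fix x :: "real ^ 'k" assume x: "x \<in> ?Q"
      define f where "f c = nat \<lfloor>real N * x $ c\<rfloor>" for c
      have "f \<in> I"
      proof -
        have "real N * x $ c \<le> real N" for c using x mult_left_le[of "x $ c" "real N"] by simp
        then have "\<lfloor>real N * x $ c\<rfloor> \<le> int N" for c using floor_mono by fastforce
        then show ?thesis by (auto simp: I_def f_def nat_le_iff)
      qed
      moreover have "x \<in> D f"
      proof -
        have "real (f c) \<le> real N * x $ c \<and> real N * x $ c \<le> real (f c) + 1" for c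
        proof -
          have "0 \<le> real N * x $ c" using x by simp
          then have "real (f c) = of_int \<lfloor>real N * x $ c\<rfloor>" unfolding f_def by simp
          then show ?thesis by linarith
        qed
        then show ?thesis using N by (auto simp: D_def field_simps)
      qed
      ultimately show "x \<in> (\<Union>f\<in>I. D f)" by blast
    qed
    have close: "norm (x - y) \<le> real ?k / N" if "x \<in> D f" "y \<in> D f" for x y f
    proof -
      have "\<bar>(x - y) $ c\<bar> \<le> 1 / N" for c
      proof -
        have "real (f c) / N \<le> x $ c" "x $ c \<le> real (f c) / N + 1 / N"
          "real (f c) / N \<le> y $ c" "y $ c \<le> real (f c) / N + 1 / N"
          using that by (auto simp: D_def add_divide_distrib)
        then show ?thesis by (simp add: abs_le_iff)
      qed
      then have "(\<Sum>c\<in>UNIV. \<bar>(x - y) $ c\<bar>) \<le> (\<Sum>c\<in>(UNIV :: 'k set). 1 / N)" by (intro sum_mono)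
      then show ?thesis using norm_le_l1_cart[of "x - y"] by simp
    qed
    \<comment> \<open>A smaller bound on the diameters leaves fewer covers, so the infimum can only
      grow.\<close>
    have "hausdorff_pre ?k \<delta> ?Q \<le> hausdorff_pre ?k (real ?k / N) ?Q"
      unfolding hausdorff_pre_def using N by (intro INF_superset_mono) (auto intro: less_imp_le le_less_trans)
    also have "\<dots> \<le> ennreal (real (card I) * (unit_ball_vol (real ?k) * (real ?k / N / 2) ^ ?k))"
    proof (rule hausdorff_pre_finite_cover[OF fin cover])
      show "bounded (D f)" for f unfolding bounded_two_points using close by (auto simp: dist_norm)
      show "diameter (D f) \<le> real ?k / N" for f using close by (intro diameter_le) auto
    qed (auto simp: Suc_le_eq)
    also have "\<dots> \<le> ennreal K"
    proof (rule ennreal_leI)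
      have "real (card I) * (unit_ball_vol (real ?k) * (real ?k / N / 2) ^ ?k) =
          unit_ball_vol (real ?k) * ((real N + 1) * (real ?k / N / 2)) ^ ?k"
        by (simp only: card power_mult_distrib of_nat_power of_nat_add of_nat_1 mult_ac)
      also have "\<dots> \<le> unit_ball_vol (real ?k) * real ?k ^ ?k"
      proof (intro mult_left_mono power_mono)
        \<comment> \<open>The factor 2 in \<open>N + 1 \<le> 2 * N\<close> is absorbed by the
          halving of the diameter.\<close>
        have "(real N + 1) * real ?k \<le> (2 * real N) * real ?k"
          using N by (intro mult_right_mono) auto
        then show "(real N + 1) * (real ?k / N / 2) \<le> real ?k"
          using N by (simp add: field_simps)
      qed auto
      finally show "real (card I) * (unit_ball_vol (real ?k) * (real ?k / N / 2) ^ ?k) \<le> K"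
        unfolding K_def .
    qed
    finally show ?thesis .
  qed
  then have "hausdorff_outer ?k ?Q \<le> ennreal K"
    unfolding hausdorff_outer_def by (intro SUP_least) auto
  then show ?thesis using le_less_trans[of _ "ennreal K" \<infinity>] by simp
qed

section \<open>Invariance of Hausdorff measure under isometries, and uniqueness of translation
  invariant measures\<close>

lemma sets_hausdorff_measure [simp, measurable_cong]: "sets (hausdorff_measure k) = sets borel"
  unfolding hausdorff_measure_def
  by (metis sets.sigma_sets_eq sets_measure_of space_borel top_greatest Pow_UNIV)

lemma space_hausdorff_measure [simp]: "space (hausdorff_measure k) = UNIV"
  unfolding hausdorff_measure_def by (simp add: space_measure_of_conv)

text \<open>\<^const>\<open>measure_of\<close> returns the zero measure if its argument is not a measure on the given
  sets. Everything below holds in either case, so Caratheodory's theorem is not needed.\<close>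

lemma emeasure_hausdorff_measure:
  fixes A :: "'a::metric_space set"
  shows
  "emeasure (hausdorff_measure k) A =
     (if A \<in> sets borel \<and> measure_space UNIV (sets borel) (hausdorff_outer k :: 'a set \<Rightarrow> _)
      then hausdorff_outer k A else 0)"
  unfolding hausdorff_measure_def emeasure_measure_of_conv
  using sets.sigma_sets_eq[of "borel :: 'a measure"] by simp

text \<open>Source and target have the same type, so that the alternative between
  \<open>hausdorff_outer\<close> and the zero measure is decided alike on both sides. An image that
  is not Borel gets the value 0.\<close>

lemma emeasure_hausdorff_nonexpansive_image:
  fixes f :: "'a::metric_space \<Rightarrow> 'a"
  assumes "\<And>x y. x \<in> A \<Longrightarrow> y \<in> A \<Longrightarrow> dist (f x) (f y) \<le> dist x y"
    and "A \<in> sets borel"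
  shows "emeasure (hausdorff_measure k) (f ` A) \<le> emeasure (hausdorff_measure k) A"
  using hausdorff_outer_nonexpansive_image[of A f k, OF assms(1)] assms(2)
  by (auto simp: emeasure_hausdorff_measure)

text \<open>The nonexpansive bound applies both to \<open>f\<close> and to its inverse on the image
  of \<open>A\<close>.\<close>

lemma emeasure_hausdorff_isometric_image:
  fixes f :: "'a::metric_space \<Rightarrow> 'a"
  assumes f: "\<And>x y. x \<in> A \<Longrightarrow> y \<in> A \<Longrightarrow> dist (f x) (f y) = dist x y"
    and A: "A \<in> sets borel" "f ` A \<in> sets borel"
  shows "emeasure (hausdorff_measure k) (f ` A) = emeasure (hausdorff_measure k) A"
proof (rule antisym)
  show "emeasure (hausdorff_measure k) (f ` A) \<le> emeasure (hausdorff_measure k) A"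
    by (rule emeasure_hausdorff_nonexpansive_image) (simp_all add: f A)
  have inj: "inj_on f A" using f by (metis dist_eq_0_iff inj_onI)
  have "emeasure (hausdorff_measure k) (the_inv_into A f ` f ` A) \<le> emeasure (hausdorff_measure k) (f ` A)"
    by (rule emeasure_hausdorff_nonexpansive_image) (auto simp: f A the_inv_into_f_f[OF inj])
  then show "emeasure (hausdorff_measure k) A \<le> emeasure (hausdorff_measure k) (f ` A)"
    by (simp add: image_image the_inv_into_f_f[OF inj])
qed

text \<open>Uniqueness of Haar measure on a Euclidean space, with the unit cube fixing the constant.
  One double integral yields the measure of \<open>A\<close> in one order of integration and the
  product on the right in the other.\<close>

lemma translation_invariant_measure_eq:
  fixes \<mu> :: "'a::euclidean_space measure"
  assumes sets [measurable_cong]: "sets \<mu> = sets borel"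
    and inv: "\<And>v A. A \<in> sets borel \<Longrightarrow> emeasure \<mu> ((+) v ` A) = emeasure \<mu> A"
    and fin: "emeasure \<mu> (cbox 0 One) < \<infinity>"
    and A: "A \<in> sets borel"
  shows "emeasure \<mu> A = emeasure \<mu> (cbox 0 One) * emeasure lborel A"
proof -
  let ?Q = "cbox 0 One :: 'a set"
  have space: "space \<mu> = UNIV" using sets_eq_imp_space_eq[OF sets] by simp
  have Qb: "(+) v ` ?Q \<in> sets borel" for v
    by (intro borel_closed closed_translation closed_cbox)
  obtain D :: "'a set" where D: "countable D" "\<And>X. open X \<Longrightarrow> X \<noteq> {} \<Longrightarrow> \<exists>d\<in>D. d \<in> X"
    using countable_dense_setE by blast
  \<comment> \<open>Fubini needs sigma-finiteness. Translates of the cube by a countable dense set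
    \<open>D\<close> cover the space, since for every \<open>x\<close> the open set of all
    \<open>x - y\<close> with \<open>y\<close> in \<open>box 0 One\<close> meets
    \<open>D\<close>.\<close>
  interpret mu: sigma_finite_measure \<mu>
  proof (standard, intro exI[of _ "(\<lambda>d. (+) d ` ?Q) ` D"] conjI ballI)
    show "countable ((\<lambda>d. (+) d ` ?Q) ` D)" using D by simp
    show "(\<lambda>d. (+) d ` ?Q) ` D \<subseteq> sets \<mu>" using Qb sets by auto
    show "\<Union> ((\<lambda>d. (+) d ` ?Q) ` D) = space \<mu>"
    proof -
      have "x \<in> \<Union> ((\<lambda>d. (+) d ` ?Q) ` D)" for x
      proof -
        have "open ((\<lambda>y. x - y) ` box 0 One)" "(\<lambda>y. x - y) ` box 0 (One::'a) \<noteq> {}"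
          using open_translation[OF open_negations[OF open_box[of 0 "One::'a"]], of x]
          by (auto simp: image_image box_ne_empty)
        then obtain d where d: "d \<in> D" "d \<in> (\<lambda>y. x - y) ` box 0 One" using D(2) by blast
        then obtain y where "y \<in> box 0 One" "d = x - y" by blast
        then have "x = d + y" "y \<in> ?Q" using box_subset_cbox by (auto simp: algebra_simps)
        then show ?thesis using d(1) by blast
      qed
      then show ?thesis by (auto simp: space)
    qed
    fix a assume "a \<in> (\<lambda>d. (+) d ` ?Q) ` D"
    then show "emeasure \<mu> a \<noteq> \<infinity>" using inv[of ?Q] fin by auto
  qed
  interpret pair_sigma_finite \<mu> lborel ..
  have distr: "distr \<mu> borel ((+) v) = \<mu>" for v
  proof (rule measure_eqI)
    fix X assume "X \<in> sets (distr \<mu> borel ((+) v))"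
    then have X [measurable]: "X \<in> sets borel" by simp
    have eq: "(+) v -` X = (+) (- v) ` X" by (force simp: image_iff)
    have "emeasure (distr \<mu> borel ((+) v)) X = emeasure \<mu> ((+) v -` X \<inter> space \<mu>)"
      by (rule emeasure_distr) simp_all
    also have "\<dots> = emeasure \<mu> X" unfolding eq space Int_UNIV_right by (rule inv[OF X])
    finally show "emeasure (distr \<mu> borel ((+) v)) X = emeasure \<mu> X" .
  qed (simp add: sets)
  have [measurable]: "A \<in> sets borel" by fact
  \<comment> \<open>The reflected cube is a translate of the cube, so by invariance it has the same
    measure.\<close>
  have um: "uminus -` ?Q = (+) (- One) ` ?Q"
  proof -
    have "uminus -` ?Q = cbox (- One) 0" 
      unfolding set_eq_iff vimage_eq mem_box by (intro allI ball_cong refl) auto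
    then show ?thesis using cbox_translation[of "- One" 0 "One :: 'a"] by simp
  qed
  \<comment> \<open>Integrate \<open>1\<^sub>A(x) 1\<^sub>Q(y - x)\<close> in both orders.\<close>
  let ?f = "\<lambda>x y. indicator A x * indicator ?Q (y - x) :: ennreal"
  have "(\<integral>\<^sup>+x. \<integral>\<^sup>+y. ?f x y \<partial>lborel \<partial>\<mu>) = (\<integral>\<^sup>+x. indicator A x * (\<integral>\<^sup>+y. indicator ?Q (y - x) \<partial>lborel) \<partial>\<mu>)"
    by (simp add: nn_integral_cmult)
  also have "\<dots> = (\<integral>\<^sup>+x. indicator A x \<partial>\<mu>)"
  proof (rule nn_integral_cong)
    fix x
    have "(\<integral>\<^sup>+y. indicator ?Q (y - x) \<partial>lborel) = (\<integral>\<^sup>+y. indicator ?Q (y - x) \<partial>(distr lborel borel ((+) x)))"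
      by (simp add: lborel_distr_plus)
    also have "\<dots> = (\<integral>\<^sup>+y. indicator ?Q y \<partial>lborel)" by (subst nn_integral_distr) auto
    also have "\<dots> = 1" by (simp add: emeasure_lborel_cbox)
    finally show "indicator A x * (\<integral>\<^sup>+y. indicator ?Q (y - x) \<partial>lborel) = (indicator A x :: ennreal)" by simp
  qed
  also have "\<dots> = emeasure \<mu> A" by (simp add: sets A)
  finally have 1: "emeasure \<mu> A = (\<integral>\<^sup>+x. \<integral>\<^sup>+y. ?f x y \<partial>lborel \<partial>\<mu>)" ..
  also have "\<dots> = (\<integral>\<^sup>+y. \<integral>\<^sup>+x. ?f x y \<partial>\<mu> \<partial>lborel)"
    by (rule Fubini'[symmetric]) simp
  \<comment> \<open>For fixed \<open>y\<close> the invariance of \<open>\<mu>\<close> allows the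
    shift of \<open>x\<close> by \<open>y\<close>, which moves \<open>y\<close> out of the indicator
    of the cube and into that of \<open>A\<close>.\<close>
  also have "\<dots> = (\<integral>\<^sup>+y. \<integral>\<^sup>+x. indicator A (y + x) * indicator ?Q (- x) \<partial>\<mu> \<partial>lborel)"
  proof (rule nn_integral_cong)
    fix y
    have "(\<integral>\<^sup>+x. ?f x y \<partial>\<mu>) = (\<integral>\<^sup>+x. ?f x y \<partial>(distr \<mu> borel ((+) y)))" by (simp add: distr)
    also have "\<dots> = (\<integral>\<^sup>+x. ?f (y + x) y \<partial>\<mu>)" by (subst nn_integral_distr) auto
    finally show "(\<integral>\<^sup>+x. ?f x y \<partial>\<mu>) = (\<integral>\<^sup>+x. indicator A (y + x) * indicator ?Q (- x) \<partial>\<mu>)" by simp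
  qed
  also have "\<dots> = (\<integral>\<^sup>+x. \<integral>\<^sup>+y. indicator A (y + x) * indicator ?Q (- x) \<partial>lborel \<partial>\<mu>)"
    by (rule Fubini') simp
  also have "\<dots> = (\<integral>\<^sup>+x. emeasure lborel A * indicator ?Q (- x) \<partial>\<mu>)"
  proof (rule nn_integral_cong)
    fix x
    have "(\<integral>\<^sup>+y. indicator A (y + x) \<partial>lborel) = (\<integral>\<^sup>+y. indicator A y \<partial>(distr lborel borel ((+) x)))"
      by (subst nn_integral_distr) (auto simp: add.commute)
    also have "\<dots> = emeasure lborel A" by (simp add: lborel_distr_plus)
    finally show "(\<integral>\<^sup>+y. indicator A (y + x) * indicator ?Q (- x) \<partial>lborel) = emeasure lborel A * indicator ?Q (- x)"
      by (simp add: nn_integral_multc)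
  qed
  also have "\<dots> = emeasure lborel A * (\<integral>\<^sup>+x. indicator (uminus -` ?Q) x \<partial>\<mu>)"
    by (subst nn_integral_cmult[symmetric]) (auto simp: indicator_def)
  also have "(\<integral>\<^sup>+x. indicator (uminus -` ?Q) x \<partial>\<mu>) = emeasure \<mu> (uminus -` ?Q)"
    by (rule nn_integral_indicator) (simp only: um sets Qb)
  also note um
  also have "emeasure \<mu> ((+) (- One) ` ?Q) = emeasure \<mu> ?Q" by (rule inv) simp
  finally show ?thesis by (simp add: mult.commute)
qed

section \<open>Hausdorff and Lebesgue measure on isometrically embedded spaces\<close>

lemma translation_borel:
  fixes A :: "'a::euclidean_space set"
  assumes "A \<in> sets borel"
  shows "(+) v ` A \<in> sets borel"
proof -
  have "(+) v ` A = (\<lambda>x. x - v) -` A" by (force simp: image_iff algebra_simps)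
  then show ?thesis using measurable_sets[of "\<lambda>x. x - v" borel borel A] assms by simp
qed

lemma linear_isometry_inner:
  fixes P :: "'a::real_inner \<Rightarrow> 'b::real_inner"
  assumes "linear P" and "\<And>x. norm (P x) = norm x"
  shows "P x \<bullet> P y = x \<bullet> y"
  by (simp add: dot_norm assms(2) flip: linear_add[OF assms(1)])

text \<open>Pulled back along \<open>P\<close>, Hausdorff measure is translation invariant and
  finite on the unit cube, hence a multiple of Lebesgue measure. The value \<open>c = 0\<close>
  covers the case of the zero measure.\<close>

lemma emeasure_hausdorff_isometric_embedding:
  fixes P :: "real ^ 'k \<Rightarrow> 'b::euclidean_space"
  assumes P: "linear P" "\<And>x. norm (P x) = norm x"
  obtains c where "c < \<infinity>"
    "\<And>A. A \<in> sets borel \<Longrightarrow> P ` A \<in> sets borel \<and>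
       emeasure (hausdorff_measure CARD('k)) (P ` A) = c * emeasure lborel A"
proof -
  let ?H = "hausdorff_measure CARD('k) :: 'b measure"
  have dist: "dist (P x) (P y) = dist x y" for x y
    by (simp add: dist_norm P(2) flip: linear_diff[OF P(1)])
  have "inj P" using dist by (metis dist_eq_0_iff injI)
  then obtain g where g: "linear g" "g \<circ> P = id"
    using linear_injective_left_inverse[OF P(1)] by blast
  have gP [simp]: "g (P x) = x" for x using fun_cong[OF g(2), of x] by simp
  have [measurable]: "g \<in> borel_measurable borel"
    by (intro borel_measurable_continuous_onI linear_continuous_on) (use g linear_conv_bounded_linear in auto)
  have R [measurable]: "range P \<in> sets borel"
    by (intro borel_closed closed_subspace linear_subspace_image[OF P(1)] subspace_UNIV)
  have img: "P ` A = g -` A \<inter> range P" for A by force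
  have gA: "g -` A \<in> sets borel" if "A \<in> sets borel" for A
    using measurable_sets[of g borel borel A] that by simp
  have PA: "P ` A \<in> sets borel" if "A \<in> sets borel" for A
    by (subst img) (rule sets.Int[OF gA[OF that] R])
  \<comment> \<open>The density restricts to the range of \<open>P\<close>; after that, preimages
    under the left inverse \<open>g\<close> amount to images under \<open>P\<close>.\<close>
  define \<mu> where "\<mu> = distr (density ?H (indicator (range P))) borel g"
  have \<mu>: "emeasure \<mu> A = emeasure ?H (P ` A)" if A [measurable]: "A \<in> sets borel" for A
  proof -
    have [measurable]: "g -` A \<in> sets borel" by (rule gA[OF A])
    have "emeasure \<mu> A = emeasure (density ?H (indicator (range P))) (g -` A)"
      unfolding \<mu>_def by (subst emeasure_distr) simp_all
    also have "\<dots> = (\<integral>\<^sup>+x. indicator (range P) x * indicator (g -` A) x \<partial>?H)"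
      by (rule emeasure_density) auto
    also have "\<dots> = (\<integral>\<^sup>+x. indicator (P ` A) x \<partial>?H)"
      by (intro nn_integral_cong) (auto simp: indicator_def)
    also have "\<dots> = emeasure ?H (P ` A)" using PA by simp
    finally show ?thesis .
  qed
  have inv: "emeasure \<mu> ((+) v ` A) = emeasure \<mu> A" if A: "A \<in> sets borel" for v A
  proof -
    note vA = translation_borel[OF A, of v]
    have e: "P ` (+) v ` A = (+) (P v) ` P ` A"
      by (simp add: image_image linear_add[OF P(1)])
    have "emeasure ?H ((+) (P v) ` P ` A) = emeasure ?H (P ` A)"
      by (rule emeasure_hausdorff_isometric_image) (use PA[OF vA] PA[OF A] e in auto)
    then show ?thesis by (simp add: \<mu> A vA e)
  qed
  let ?Q = "cbox 0 One :: (real ^ 'k) set"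
  have fin: "emeasure \<mu> ?Q < \<infinity>"
  proof -
    have "(One :: real ^ 'k) $ c = 1" for c
      unfolding cart_eq_inner_axis by (simp add: axis_in_Basis_iff)
    then have Q: "?Q = {x. \<forall>c. 0 \<le> x $ c \<and> x $ c \<le> 1}"
      by (simp add: set_eq_iff mem_box_cart)
    have "emeasure \<mu> ?Q \<le> hausdorff_outer CARD('k) (P ` ?Q)"
      by (subst \<mu>) (auto simp: emeasure_hausdorff_measure)
    also have "\<dots> \<le> hausdorff_outer CARD('k) ?Q"
      by (rule hausdorff_outer_nonexpansive_image) (simp add: dist)
    also have "\<dots> < \<infinity>"
      unfolding Q by (rule hausdorff_outer_unit_cube_finite)
    finally show ?thesis .
  qed
  show ?thesis
  proof (rule that)
    show "emeasure \<mu> ?Q < \<infinity>" by (rule fin)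
    fix A :: "(real ^ 'k) set" assume A: "A \<in> sets borel"
    show "P ` A \<in> sets borel \<and> emeasure ?H (P ` A) = emeasure \<mu> ?Q * emeasure lborel A"
      using translation_invariant_measure_eq[OF _ inv fin A] PA[OF A] \<mu>[OF A]
      by (simp add: \<mu>_def)
  qed
qed

text \<open>Hausdorff measure is proportional to Lebesgue measure on the range of \<open>P\<close>,
  and Lebesgue measure scales by the determinant. \<open>N\<close> may be singular: a collapsed
  image has measure 0.\<close>

lemma measure_hausdorff_linear_image:
  fixes P P' :: "real ^ 'k::{finite,wellorder} \<Rightarrow> 'b::euclidean_space"
    and N :: "real ^ 'k::{finite,wellorder} \<Rightarrow> real ^ 'k::{finite,wellorder}"
  assumes P: "linear P" "\<And>x. norm (P x) = norm x"
    and P': "linear P'" "\<And>x. norm (P' x) = norm x"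
    and N: "linear N"
    and A: "bounded A" "A \<in> sets borel" "N ` A \<in> sets borel"
  shows "emeasure (hausdorff_measure CARD('k)) (P ` A) < \<infinity>"
    and "measure (hausdorff_measure CARD('k)) (P' ` N ` A) =
      \<bar>det (matrix N)\<bar> * measure (hausdorff_measure CARD('k)) (P ` A)"
proof -
  let ?H = "hausdorff_measure CARD('k) :: 'b measure"
  obtain c where c: "c < \<infinity>" "\<And>A. A \<in> sets borel \<Longrightarrow> P ` A \<in> sets borel \<and>
      emeasure ?H (P ` A) = c * emeasure lborel A"
    by (rule emeasure_hausdorff_isometric_embedding[OF P]) blast
  obtain c' where c': "\<And>A. A \<in> sets borel \<Longrightarrow> P' ` A \<in> sets borel"
    by (rule emeasure_hausdorff_isometric_embedding[OF P']) blast
  have fA: "emeasure lborel A < \<infinity>" by (rule emeasure_bounded_finite[OF A(1)])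
  then show "emeasure ?H (P ` A) < \<infinity>" using c A(2) by (simp add: ennreal_mult_less_top)
  have meas: "measure ?H (P ` B) = enn2real c * measure lborel B" if "B \<in> sets borel" for B
    using c(2)[OF that] by (simp add: measure_def enn2real_mult)
  have dist: "dist (P x) (P y) = dist x y" "dist (P' x) (P' y) = dist x y" for x y
    by (simp_all add: dist_norm P(2) P'(2) flip: linear_diff[OF P(1)] linear_diff[OF P'(1)])
  have "inj P" using dist by (metis dist_eq_0_iff injI)
  then have inv: "inv P (P x) = x" for x by simp
  \<comment> \<open>The constants of \<open>P\<close> and \<open>P'\<close> could differ a priori.
    The isometry \<open>P' \<circ> inv P\<close> between the two ranges lets the constant
    \<open>c\<close> of \<open>P\<close> serve for both.\<close>
  have "emeasure ?H ((P' \<circ> inv P) ` P ` N ` A) = emeasure ?H (P ` N ` A)"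
    by (rule emeasure_hausdorff_isometric_image) (use c(2)[OF A(3)] c'[OF A(3)] in \<open>auto simp: inv dist image_image\<close>)
  then have "measure ?H (P' ` N ` A) = measure ?H (P ` N ` A)"
    by (simp add: measure_def image_image inv)
  also have "\<dots> = enn2real c * measure lborel (N ` A)" by (rule meas) fact
  also have "measure lborel (N ` A) = measure lebesgue (N ` A)" using A by (simp add: measure_completion)
  also have "\<dots> = \<bar>det (matrix N)\<bar> * measure lebesgue A"
    by (rule measure_linear_image[OF N]) (simp add: A bounded_set_imp_lmeasurable)
  also have "measure lebesgue A = measure lborel A" using A by (simp add: measure_completion)
  finally show "measure ?H (P' ` N ` A) = \<bar>det (matrix N)\<bar> * measure ?H (P ` A)"
    by (simp add: meas A)
qed

section \<open>Surface gradients and change of area\<close>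

text \<open>The constant surface gradient of a map that is affine on \<open>S\<close>, described by
  differences instead of derivatives. Requiring the rows to lie in the direction space makes
  \<open>G\<close> unique.\<close>

definition tangential_slope :: "(real ^ 'd) set \<Rightarrow> (real ^ 'd \<Rightarrow> real ^ 'd) \<Rightarrow> real ^ 'd ^ 'd \<Rightarrow> bool" where
  "tangential_slope S X G \<longleftrightarrow>
     (\<forall>c. G $ c \<in> span {y - z | y z. y \<in> S \<and> z \<in> S}) \<and>
     (\<forall>y\<in>S. \<forall>z\<in>S. \<forall>c. X y $ c - X z $ c = G $ c \<bullet> (y - z))"

lemma tangential_slope_diff:
  assumes "tangential_slope S X G" and "tangential_slope S Y H"
  shows "tangential_slope S (\<lambda>x. X x - Y x) (G - H)"
proof -
  have "(X y - Y y) $ c - (X z - Y z) $ c = (G - H) $ c \<bullet> (y - z)"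
    if "y \<in> S" "z \<in> S" for y z c
  proof -
    have "X y $ c - X z $ c = G $ c \<bullet> (y - z)" "Y y $ c - Y z $ c = H $ c \<bullet> (y - z)"
      using assms that by (auto simp: tangential_slope_def)
    then show ?thesis by (simp add: inner_diff_left)
  qed
  then show ?thesis using assms by (auto simp: tangential_slope_def intro: span_diff)
qed

lemma span_differences:
  fixes S :: "'a::euclidean_space set"
  assumes x: "x \<in> S"
  shows "span {y - z | y z. y \<in> S \<and> z \<in> S} = span ((\<lambda>y. y - x) ` S)"
proof (rule span_eq[THEN iffD2], intro conjI subsetI)
  fix w assume "w \<in> {y - z | y z. y \<in> S \<and> z \<in> S}"
  then obtain y z where yz: "w = (y - x) - (z - x)" "y \<in> S" "z \<in> S" by auto
  show "w \<in> span ((\<lambda>y. y - x) ` S)" unfolding yz(1) by (intro span_diff span_base) (use yz in auto)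
next
  fix w assume "w \<in> (\<lambda>y. y - x) ` S"
  then show "w \<in> span {y - z | y z. y \<in> S \<and> z \<in> S}" using x by (intro span_base) auto
qed

lemma affine_hull_add_span_differences:
  fixes S :: "'a::euclidean_space set"
  assumes x: "x \<in> S" and w: "w \<in> span {y - z | y z. y \<in> S \<and> z \<in> S}"
  shows "x + w \<in> affine hull S"
proof -
  have "span ((\<lambda>y. y - x) ` S) \<subseteq> span ((\<lambda>y. - x + y) ` (S - {x}))"
  proof (rule span_minimal)
    show "(\<lambda>y. y - x) ` S \<subseteq> span ((\<lambda>y. - x + y) ` (S - {x}))"
    proof clarify
      fix y assume y: "y \<in> S"
      show "y - x \<in> span ((\<lambda>y. - x + y) ` (S - {x}))"
      proof (cases "y = x")
        case True
        then show ?thesis by (simp add: span_zero)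
      next
        case False
        then show ?thesis using y by (intro span_base) (auto intro!: image_eqI[of _ _ y])
      qed
    qed
  qed simp
  then show ?thesis using w affine_hull_span2[OF x] by (auto simp: span_differences[OF x])
qed

text \<open>The definite description needs uniqueness. Two candidates differ by a vector
  \<open>w\<close> of the direction space. As \<open>S\<close> is open in its affine hull, it
  contains a short segment through \<open>x\<close> along \<open>w\<close>, and differentiating
  along it gives \<open>w \<bullet> w = 0\<close>.\<close>

lemma tangential_grad_eq:
  fixes S :: "'a::euclidean_space set"
  assumes S: "openin (top_of_set (affine hull S)) S" and x: "x \<in> S"
    and g: "g \<in> span {y - z | y z. y \<in> S \<and> z \<in> S}"
    and f: "\<And>y. y \<in> S \<Longrightarrow> f y - f x = g \<bullet> (y - x)"
  shows "tangential_grad S f x = g"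
  unfolding tangential_grad_def
proof (rule the_equality)
  have f': "(f has_derivative (\<lambda>h. g \<bullet> h)) (at x within S)"
  proof (rule has_derivative_transform[OF x])
    show "f y = f x + g \<bullet> (y - x)" if "y \<in> S" for y using f[OF that] by simp
    show "((\<lambda>y. f x + g \<bullet> (y - x)) has_derivative (\<lambda>h. g \<bullet> h)) (at x within S)"
      by (auto intro!: derivative_eq_intros)
  qed
  then show "g \<in> span {y - z | y z. y \<in> S \<and> z \<in> S} \<and> (f has_derivative (\<lambda>h. g \<bullet> h)) (at x within S)"
    using g by simp
  fix g' assume g': "g' \<in> span {y - z | y z. y \<in> S \<and> z \<in> S} \<and> (f has_derivative (\<lambda>h. g' \<bullet> h)) (at x within S)"
  define w where "w = g' - g"
  have w: "w \<in> span {y - z | y z. y \<in> S \<and> z \<in> S}" unfolding w_def using g g' by (intro span_diff) auto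
  obtain T where T: "open T" "S = affine hull S \<inter> T" using S by (auto simp: openin_open)
  define U where "U = (\<lambda>r::real. x + r *\<^sub>R w) -` T"
  have U: "open U" unfolding U_def by (intro open_vimage T continuous_intros)
  have U0: "0 \<in> U" using x T by (auto simp: U_def)
  have US: "(\<lambda>r. x + r *\<^sub>R w) ` U \<subseteq> S"
    using affine_hull_add_span_differences[OF x span_scale[OF w]] T(2) by (auto simp: U_def)
  have "((\<lambda>y. f y - f y) has_derivative (\<lambda>h. g' \<bullet> h - g \<bullet> h)) (at x within S)"
    using has_derivative_diff[OF conjunct2[OF g'] f'] .
  then have z: "((\<lambda>y. 0::real) has_derivative (\<lambda>h. w \<bullet> h)) (at x within S)"
    by (simp add: w_def inner_diff_left)
  have "((\<lambda>r. x + r *\<^sub>R w) has_derivative (\<lambda>r. r *\<^sub>R w)) (at 0 within U)"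
    by (auto intro!: derivative_eq_intros)
  then have "((\<lambda>r. 0::real) has_derivative (\<lambda>r. w \<bullet> (r *\<^sub>R w))) (at 0 within U)"
    by (rule has_derivative_in_compose) (use has_derivative_subset[OF z US] in simp)
  then have "((\<lambda>r. 0::real) has_derivative (\<lambda>r. w \<bullet> (r *\<^sub>R w))) (at 0)"
    by (simp add: at_within_open[OF U0 U])
  then have "(\<lambda>r. w \<bullet> (r *\<^sub>R w)) = (\<lambda>r. 0)"
    by (rule has_derivative_unique) (rule has_derivative_const)
  from fun_cong[OF this, of 1] show "g' = g" by (simp add: w_def)
qed

lemma tangential_slope_tangential_grad:
  assumes "tangential_slope S X G" and "openin (top_of_set (affine hull S)) S" and "x \<in> S"
  shows "tangential_grad S (\<lambda>y. X y $ c) x = G $ c"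
  using assms by (intro tangential_grad_eq) (auto simp: tangential_slope_def)

text \<open>Riesz representation on the range of \<open>P\<close>: the coordinates of the
  representing vector are the values of \<open>L\<close> on the orthonormal basis
  \<open>P (axis j 1)\<close>.\<close>

lemma linear_functional_on_isometric_image:
  fixes P :: "real ^ 'k \<Rightarrow> 'b::euclidean_space" and L :: "'b \<Rightarrow> real"
  assumes P: "linear P" "\<And>x. norm (P x) = norm x" and L: "linear L"
  shows "P (\<chi> j. L (P (axis j 1))) \<bullet> P u = L (P u)"
proof -
  have lin: "linear (\<lambda>u. L (P u))" using linear_compose[OF P(1) L] by (simp add: o_def)
  have "L (P u) = L (P (\<Sum>j\<in>UNIV. u $ j *\<^sub>R axis j 1))"
    using basis_expansion[of u] by (simp add: scalar_mult_eq_scaleR)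
  also have "\<dots> = (\<Sum>j\<in>UNIV. u $ j * L (P (axis j 1)))"
    by (simp add: linear_sum[OF lin] linear_scale[OF lin])
  finally show ?thesis
    by (simp add: linear_isometry_inner[OF P] inner_vec_def mult.commute)
qed

text \<open>Each row of \<open>G\<close> is the Riesz representative, within the direction space, of
  the linear part of one component of \<open>X\<close>.\<close>

lemma tangential_slope_exists:
  fixes P :: "real ^ 'k \<Rightarrow> real ^ 'd"
  assumes P: "linear P" "\<And>x. norm (P x) = norm x"
    and V: "range P = span {y - z | y z. y \<in> S \<and> z \<in> S}"
    and X: "\<And>c. affine_map_on S (\<lambda>y. X y $ c)"
  obtains G where "tangential_slope S X G"
proof -
  have "\<forall>c. \<exists>L b. linear L \<and> (\<forall>y\<in>S. X y $ c = L y + b)"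
    using X by (auto simp: affine_map_on_def)
  then obtain L b where L: "\<And>c. linear (L c)" "\<And>c y. y \<in> S \<Longrightarrow> X y $ c = L c y + b c"
    by metis
  have "tangential_slope S X (\<chi> c. P (\<chi> j. L c (P (axis j 1))))"
    unfolding tangential_slope_def
  proof (intro conjI allI ballI)
    show "(\<chi> c. P (\<chi> j. L c (P (axis j 1)))) $ c \<in> span {y - z | y z. y \<in> S \<and> z \<in> S}" for c
      unfolding V[symmetric] by simp
    fix y z c assume yz: "y \<in> S" "z \<in> S"
    then have "y - z \<in> range P" unfolding V by (intro span_base) auto
    then obtain u where u: "y - z = P u" by auto
    show "X y $ c - X z $ c = (\<chi> c. P (\<chi> j. L c (P (axis j 1)))) $ c \<bullet> (y - z)"
      unfolding u vec_lambda_beta linear_functional_on_isometric_image[OF P L(1)]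
      by (simp add: L yz flip: u linear_diff[OF L(1)])
  qed
  then show ?thesis by (rule that)
qed

text \<open>Parseval for each row in the orthonormal basis \<open>P (axis j 1)\<close>, followed by
  an exchange of the two sums.\<close>

lemma norm_slope:
  fixes P :: "real ^ 'k \<Rightarrow> real ^ 'd" and G :: "real ^ 'd ^ 'd"
  assumes P: "linear P" "\<And>x. norm (P x) = norm x" and G: "\<And>c. G $ c \<in> range P"
  shows "(norm G)\<^sup>2 = (\<Sum>j\<in>UNIV. (norm (G *v P (axis j 1)))\<^sup>2)"
proof -
  have row: "(norm (G $ c))\<^sup>2 = (\<Sum>j\<in>UNIV. (G $ c \<bullet> P (axis j 1))\<^sup>2)" for c
  proof -
    obtain r where r: "G $ c = P r" using G by blast
    show ?thesis
      unfolding r linear_isometry_inner[OF P] P(2)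
      by (simp add: cart_eq_inner_axis[symmetric] norm_vec_def L2_set_def sum_nonneg)
  qed
  have "(norm G)\<^sup>2 = (\<Sum>c\<in>UNIV. (norm (G $ c))\<^sup>2)"
    by (simp add: norm_vec_def[of G] L2_set_def sum_nonneg)
  also have "\<dots> = (\<Sum>j\<in>UNIV. \<Sum>c\<in>UNIV. (G $ c \<bullet> P (axis j 1))\<^sup>2)"
    unfolding row by (rule sum.swap)
  also have "\<dots> = (\<Sum>j\<in>UNIV. (norm (G *v P (axis j 1)))\<^sup>2)"
    by (simp add: norm_vec_def[of "G *v _"] L2_set_def sum_nonneg matrix_vector_mul_component)
  finally show ?thesis .
qed

section \<open>The area of the affine image of a flat piece\<close>

lemma rel_interior_borel: "rel_interior (S :: 'a::euclidean_space set) \<in> sets borel"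
proof -
  obtain T where "open T" "rel_interior S = affine hull S \<inter> T"
    using openin_rel_interior[of S] by (auto simp: openin_open)
  then show ?thesis by (auto intro!: borel_closed closed_affine_hull sets.Int)
qed

lemma emeasure_hausdorff_translation:
  fixes A :: "'a::euclidean_space set"
  assumes "A \<in> sets borel"
  shows "emeasure (hausdorff_measure k) ((+) v ` A) = emeasure (hausdorff_measure k) A"
  by (rule emeasure_hausdorff_isometric_image) (use assms translation_borel in auto)

lemma isometric_parametrization:
  fixes V :: "'b::euclidean_space set"
  assumes "subspace V" and "dim V = CARD('k)"
  obtains P :: "real ^ 'k \<Rightarrow> 'b" where "linear P" "\<And>x. norm (P x) = norm x" "range P = V"
  by (rule isometries_subspaces[OF subspace_UNIV assms(1), where 'a="real ^ 'k"])
    (use assms in auto)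

text \<open>In isometric coordinates on source and target, \<open>X\<close> is a square matrix up to
  translations, and the area changes by the modulus of its determinant. The hypothesis
  \<open>det\<close> isolates the one inequality that depends on the size; it is supplied afterwards
  for sizes 1 and 2.\<close>

lemma area_change_le:
  fixes S :: "(real ^ 'd) set"
  assumes S: "convex S" "openin (top_of_set (affine hull S)) S" "bounded S" "S \<noteq> {}"
    and dim: "aff_dim S = int CARD('k)" "CARD('d) = CARD('k::{finite,wellorder}) + 1"
    and det: "\<And>N :: ((real, 'k) vec, 'k) vec. \<bar>det N\<bar> \<le> (norm N)\<^sup>2 / 2 + 1 - real CARD('k) / 2"
    and X: "\<And>c. affine_map_on S (\<lambda>y. X y $ c)"
  obtains G H where "tangential_slope S X G" "tangential_slope S id H"
    "emeasure (surface_measure :: (real ^ 'd) measure) S < \<infinity>"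
    "measure surface_measure (X ` S) \<le> measure surface_measure S * (1 + G \<bullet> (G - H))"
proof -
  let ?H = "surface_measure :: (real ^ 'd) measure"
  let ?V = "span {y - z | y z. y \<in> S \<and> z \<in> S}"
  have k: "CARD('d) - 1 = CARD('k)" using dim by simp
  obtain x where x: "x \<in> S" using S by blast
  have dimV: "dim ?V = CARD('k)"
    using aff_dim_eq_dim_subtract[of x S] dim(1) x by (simp add: span_differences[OF x] hull_inc)
  obtain P :: "(real, 'k) vec \<Rightarrow> real ^ 'd" where P: "linear P" "\<And>x. norm (P x) = norm x" "range P = ?V"
    using isometric_parametrization[OF subspace_span dimV] by blast
  obtain G where G: "tangential_slope S X G" using tangential_slope_exists[OF P X] by blast
  have "affine_map_on S (\<lambda>y. id y $ c)" for c
    unfolding affine_map_on_def by (intro exI[of _ "\<lambda>y. y $ c"] exI[of _ 0]) (simp add: bounded_linear.linear[OF bounded_linear_vec_nth])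
  then obtain H where H: "tangential_slope S id H" using tangential_slope_exists[OF P] by blast
  have GP: "G $ c \<in> range P" and HP: "H $ c \<in> range P" for c
    using G H P(3) by (auto simp: tangential_slope_def)
  have linG: "linear ((*v) G)" by (rule matrix_vector_mul_linear)
  have Xy: "X y = X x + G *v (y - x)" if "y \<in> S" for y
    using G that x by (auto simp: tangential_slope_def vec_eq_iff matrix_vector_mul_component algebra_simps)
  \<comment> \<open>\<open>H\<close> is the orthogonal projection onto the direction space; each of
    the \<open>CARD('k)\<close> basis vectors thus contributes 1 to its squared norm.\<close>
  have HPu: "H *v (P u) = P u" for u
  proof -
    have sub: "subspace {w. H *v w = w}"
      by (auto simp: subspace_def matrix_vector_right_distrib matrix_vector_mult_scaleR)
    have "?V \<subseteq> {w. H *v w = w}"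
    proof (rule span_minimal[OF _ sub], clarify)
      fix y z assume "y \<in> S" "z \<in> S"
      then have "(y - z) $ c = H $ c \<bullet> (y - z)" for c using H by (auto simp: tangential_slope_def)
      then show "H *v (y - z) = y - z" by (simp add: vec_eq_iff matrix_vector_mul_component)
    qed
    then show ?thesis using P(3) by blast
  qed
  have nH: "(norm H)\<^sup>2 = real CARD('k)"
    by (simp add: norm_slope[OF P(1,2) HP] HPu P(2))
  \<comment> \<open>The image of the direction space under \<open>G\<close> may have dimension below
    \<open>CARD('k)\<close>. A hyperplane containing it has exactly this dimension, so it can be
    parametrized isometrically by \<open>P'\<close>.\<close>
  have "dim ((*v) G ` ?V) < DIM(real ^ 'd)"
    using dim_image_le[OF linG, of ?V] dimV dim by (simp add: dim_span)
  then obtain n where n: "n \<noteq> 0" "\<And>w. w \<in> span ((*v) G ` ?V) \<Longrightarrow> orthogonal n w"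
    using orthogonal_to_subspace_exists by blast
  obtain P' :: "(real, 'k) vec \<Rightarrow> real ^ 'd" and g' where P': "linear P'" "\<And>x. norm (P' x) = norm x"
    and g': "linear g'" "\<And>w. n \<bullet> w = 0 \<Longrightarrow> P' (g' w) = w"
  proof (rule isometries_subspaces[OF subspace_UNIV subspace_hyperplane[of n], where 'a="(real, 'k) vec"])
    show "dim (UNIV :: (real, 'k) vec set) = dim {x. n \<bullet> x = 0}"
      using dim by (simp add: dim_hyperplane[OF n(1)])
  qed (use that in auto)
  define N where "N u = g' (G *v P u)" for u
  have N: "linear N" unfolding N_def
    using linear_compose[OF linear_compose[OF P(1) linG] g'(1)] by (simp add: o_def)
  have P'N: "P' (N u) = G *v P u" for u
  proof -
    have "G *v P u \<in> span ((*v) G ` ?V)" using P(3) by (intro span_base) auto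
    then show ?thesis unfolding N_def using n(2) g'(2) by (simp add: orthogonal_def)
  qed
  \<comment> \<open>Both norms are sums over the same basis: the columns of \<open>matrix N\<close>
    are carried by the isometry \<open>P'\<close> to the images under \<open>G\<close> of the
    vectors \<open>P (axis j 1)\<close>.\<close>
  have nN: "(norm (matrix N))\<^sup>2 = (norm G)\<^sup>2"
  proof -
    have "(norm (matrix N))\<^sup>2 = (norm (transpose (matrix N)))\<^sup>2"
    proof -
      have "(\<Sum>i\<in>UNIV. \<Sum>j\<in>UNIV. (matrix N $ i $ j)\<^sup>2) = (\<Sum>j\<in>UNIV. \<Sum>i\<in>UNIV. (matrix N $ i $ j)\<^sup>2)"
        by (rule sum.swap)
      then show ?thesis by (simp add: norm_vec_def L2_set_def sum_nonneg transpose_def)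
    qed
    also have "\<dots> = (\<Sum>j\<in>UNIV. (norm (N (axis j 1)))\<^sup>2)"
      by (simp add: norm_vec_def L2_set_def sum_nonneg transpose_def matrix_def)
    also have "\<dots> = (\<Sum>j\<in>UNIV. (norm (G *v P (axis j 1)))\<^sup>2)"
      by (simp flip: P'N add: P'(2))
    also have "\<dots> = (norm G)\<^sup>2" by (rule norm_slope[OF P(1,2) GP, symmetric])
    finally show ?thesis .
  qed
  define S\<^sub>0 where "S\<^sub>0 = {u. x + P u \<in> S}"
  have S_img: "S = (+) x ` P ` S\<^sub>0"
  proof (intro equalityI subsetI)
    fix y assume y: "y \<in> S"
    then have "y - x \<in> range P" unfolding P(3) using x by (intro span_base) auto
    then obtain u where "y - x = P u" by auto
    then have "y = x + P u" by (simp add: algebra_simps)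
    then show "y \<in> (+) x ` P ` S\<^sub>0" using y by (auto simp: S\<^sub>0_def)
  qed (auto simp: S\<^sub>0_def)
  have X_img: "X ` S = (+) (X x) ` P' ` N ` S\<^sub>0"
  proof -
    have "X (x + P u) = X x + P' (N u)" if "u \<in> S\<^sub>0" for u
      using Xy[of "x + P u"] that by (simp add: S\<^sub>0_def P'N)
    then show ?thesis unfolding S_img[unfolded image_image] image_image by (intro image_cong) auto
  qed
  have contP: "continuous_on UNIV P" using P(1) linear_conv_bounded_linear linear_continuous_on by blast
  obtain T where T: "open T" "S = affine hull S \<inter> T" using S(2) by (auto simp: openin_open)
  \<comment> \<open>All points \<open>x + P u\<close> lie in the affine hull of \<open>S\<close>, so
    relative openness of \<open>S\<close> becomes openness of \<open>S\<^sub>0\<close>.\<close>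
  have "S\<^sub>0 = (\<lambda>u. x + P u) -` T"
  proof -
    have "x + P u \<in> affine hull S" for u
      using affine_hull_add_span_differences[OF x] P(3) by blast
    then show ?thesis using T(2) by (auto simp: S\<^sub>0_def)
  qed
  then have open0: "open S\<^sub>0" by (simp add: open_vimage[OF T(1)] continuous_on_add contP)
  have convex0: "convex S\<^sub>0"
  proof -
    have "S\<^sub>0 = P -` ((\<lambda>y. y - x) ` S)" by (force simp: S\<^sub>0_def image_iff algebra_simps)
    then show ?thesis
      using convex_linear_vimage[OF P(1)] convex_translation_subtract[OF S(1)] by metis
  qed
  have bounded0: "bounded S\<^sub>0"
  proof -
    obtain b where b: "\<And>y. y \<in> S \<Longrightarrow> norm y \<le> b" using S(3) by (auto simp: bounded_iff)
    have "norm u \<le> b + norm x" if "u \<in> S\<^sub>0" for u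
    proof -
      have "norm u = norm ((x + P u) - x)" by (simp add: P(2))
      also have "\<dots> \<le> norm (x + P u) + norm x" by (rule norm_triangle_ineq4)
      finally show ?thesis using b[of "x + P u"] that by (simp add: S\<^sub>0_def)
    qed
    then show ?thesis by (auto simp: bounded_iff)
  qed
  have bor0: "S\<^sub>0 \<in> sets borel" using open0 by simp
  \<comment> \<open>For singular \<open>N\<close> the image is not open. Being the linear image of
    an open convex set, it still equals its own relative interior, which is Borel.\<close>
  have borN: "N ` S\<^sub>0 \<in> sets borel"
    using rel_interior_convex_linear_image[OF N convex0] rel_interior_borel[of "N ` S\<^sub>0"]
    by (simp add: rel_interior_open[OF open0])
  have borP: "P ` S\<^sub>0 \<in> sets borel"
    by (rule emeasure_hausdorff_isometric_embedding[OF P(1,2)]) (use bor0 in blast)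
  have borP': "P' ` N ` S\<^sub>0 \<in> sets borel"
    by (rule emeasure_hausdorff_isometric_embedding[OF P'(1,2)]) (use borN in blast)
  note change = measure_hausdorff_linear_image[OF P(1,2) P' N bounded0 bor0 borN, folded k]
  have eS: "emeasure ?H S = emeasure ?H (P ` S\<^sub>0)"
    unfolding S_img by (rule emeasure_hausdorff_translation[OF borP])
  have eX: "emeasure ?H (X ` S) = emeasure ?H (P' ` N ` S\<^sub>0)"
    unfolding X_img by (rule emeasure_hausdorff_translation[OF borP'])
  have "measure ?H (X ` S) = \<bar>det (matrix N)\<bar> * measure ?H S"
    using change(2) eS eX by (simp add: measure_def)
  also have "\<dots> \<le> (1 + G \<bullet> (G - H)) * measure ?H S"
  proof (rule mult_right_mono)
    have "0 \<le> (norm (G - H))\<^sup>2" by simp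
    also have "(norm (G - H))\<^sup>2 = (norm G)\<^sup>2 - 2 * (G \<bullet> H) + (norm H)\<^sup>2"
      by (simp add: power2_norm_eq_inner inner_diff_left inner_diff_right inner_commute)
    finally have "G \<bullet> H \<le> (norm G)\<^sup>2 / 2 + real CARD('k) / 2" using nH by simp
    moreover have "\<bar>det (matrix N)\<bar> \<le> (norm G)\<^sup>2 / 2 + 1 - real CARD('k) / 2"
      using det[of "matrix N"] nN by simp
    moreover have "G \<bullet> (G - H) = (norm G)\<^sup>2 - G \<bullet> H"
      by (simp add: inner_diff_right power2_norm_eq_inner)
    ultimately show "\<bar>det (matrix N)\<bar> \<le> 1 + G \<bullet> (G - H)" by simp
  qed simp
  finally show ?thesis
    using that[OF G H] change(1) eS by (simp add: mult.commute)
qed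

text \<open>For size 1 the constant is \<open>1 / 2\<close>, and the bound expands a square: the
  modulus of the entry minus 1.\<close>

lemma abs_det_1_le:
  fixes N :: "real ^ 1 ^ 1"
  shows "\<bar>det N\<bar> \<le> (norm N)\<^sup>2 / 2 + 1 - real CARD(1) / 2"
proof -
  have "0 \<le> (\<bar>N $ 1 $ 1\<bar> - 1)\<^sup>2" by simp
  then have "\<bar>N $ 1 $ 1\<bar> \<le> (N $ 1 $ 1)\<^sup>2 / 2 + 1 / 2" by (simp add: power2_diff)
  then show ?thesis by (simp add: det_1 norm_vec_def L2_set_def)
qed

text \<open>For size 2 the constants cancel. The two sums of squares bound the determinant and its
  negative.\<close>

lemma abs_det_2_le:
  fixes N :: "real ^ 2 ^ 2"
  shows "\<bar>det N\<bar> \<le> (norm N)\<^sup>2 / 2 + 1 - real CARD(2) / 2"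
proof -
  let ?a = "N $ 1 $ 1" and ?b = "N $ 1 $ 2" and ?c = "N $ 2 $ 1" and ?d = "N $ 2 $ 2"
  have "0 \<le> (?a - ?d)\<^sup>2 + (?b + ?c)\<^sup>2" "0 \<le> (?a + ?d)\<^sup>2 + (?b - ?c)\<^sup>2" by simp_all
  then have "\<bar>?a * ?d - ?b * ?c\<bar> \<le> (?a\<^sup>2 + ?b\<^sup>2 + (?c\<^sup>2 + ?d\<^sup>2)) / 2"
    by (intro abs_leI) (simp_all add: power2_diff power2_sum algebra_simps)
  then show ?thesis by (simp add: det_2 norm_vec_def L2_set_def sum_2)
qed

section \<open>Finite element spaces\<close>

lemma hypersurface_simplex:
  fixes M :: "(real ^ 'd) mesh"
  assumes M: "polyhedral_hypersurface M" and s: "s \<in> M"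
  shows "length s = CARD('d)" and "\<not> affine_dependent (set s)" and "card (set s) = CARD('d)"
  using assms by (auto simp: polyhedral_hypersurface_def distinct_card)

lemma open_simplex_props:
  fixes s :: "'a::euclidean_space list"
  shows "convex (open_simplex s)"
    and "openin (top_of_set (affine hull open_simplex s)) (open_simplex s)"
    and "bounded (open_simplex s)"
    and "open_simplex s \<in> sets borel"
    and "closure (open_simplex s) = convex hull set s"
    and "open_simplex s \<subseteq> convex hull set s"
    and "aff_dim (open_simplex s) = aff_dim (set s)"
    and "s \<noteq> [] \<Longrightarrow> open_simplex s \<noteq> {}"
proof -
  let ?K = "convex hull set s"
  have K: "convex ?K" "compact ?K" by (auto simp: finite_imp_compact_convex_hull)
  have hull: "affine hull rel_interior ?K = affine hull ?K"
    by (rule rel_interior_same_affine_hull[OF K(1)])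
  show "convex (open_simplex s)" unfolding open_simplex_def by (rule convex_rel_interior[OF K(1)])
  show "openin (top_of_set (affine hull open_simplex s)) (open_simplex s)"
    unfolding open_simplex_def hull by (rule openin_rel_interior)
  show sub: "open_simplex s \<subseteq> ?K" unfolding open_simplex_def by (rule rel_interior_subset)
  show "bounded (open_simplex s)" using bounded_subset[OF compact_imp_bounded[OF K(2)] sub] .
  show "open_simplex s \<in> sets borel" unfolding open_simplex_def by (rule rel_interior_borel)
  show "closure (open_simplex s) = ?K"
    unfolding open_simplex_def convex_closure_rel_interior[OF K(1)]
    using compact_imp_closed[OF K(2)] by simp
  show "aff_dim (open_simplex s) = aff_dim (set s)"
    unfolding open_simplex_def by (metis hull aff_dim_affine_hull aff_dim_convex_hull)
  show "open_simplex s \<noteq> {}" if "s \<noteq> []"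
    unfolding open_simplex_def using that by (simp add: rel_interior_eq_empty[OF K(1)])
qed

lemma mesh_carrier_eq: "mesh_carrier M = (\<Union>s\<in>M. convex hull set s)"
  by (simp add: mesh_carrier_def open_simplex_props(5))

lemma mesh_carrier_vertex: "s \<in> M \<Longrightarrow> k < length s \<Longrightarrow> s ! k \<in> mesh_carrier M"
  unfolding mesh_carrier_eq using hull_subset[of "set s" convex] by fastforce

text \<open>The point is that the filter is nontrivial. A simplex with at least two vertices is
  connected and not a singleton, so each vertex is a limit point of it and therefore of the open
  simplex, whose closure it is.\<close>

lemma Lim_at_vertex:
  fixes M :: "(real ^ 'd) mesh" and f :: "real ^ 'd \<Rightarrow> 'b::t2_space"
  assumes M: "polyhedral_hypersurface M" and d: "CARD('d) \<ge> 2"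
    and s: "s \<in> M" and k: "k < CARD('d)" and f: "continuous_on (mesh_carrier M) f"
  shows "Lim (at (s ! k) within open_simplex s) f = f (s ! k)"
proof (rule tendsto_Lim)
  note h = hypersurface_simplex[OF M s]
  have mem: "s ! k \<in> set s" using h k by simp
  have "\<exists>y\<in>set s. y \<noteq> s ! k"
  proof (rule ccontr)
    assume "\<not> ?thesis"
    then have "set s \<subseteq> {s ! k}" by blast
    then have "card (set s) \<le> 1" using card_mono[of "{s ! k}" "set s"] by simp
    then show False using h d by simp
  qed
  then obtain y where y: "y \<in> set s" "y \<noteq> s ! k" by blast
  have hull: "set s \<subseteq> convex hull set s" by (rule hull_subset)
  have "convex hull set s \<noteq> {x}" for x using hull mem y by (metis singletonD subsetD)
  then have "s ! k islimpt convex hull set s"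
    using hull mem by (intro connected_imp_perfect) (auto intro: convex_connected)
  then have "s ! k islimpt open_simplex s"
    using limpt_of_closure[of "s ! k" "open_simplex s"] by (simp add: open_simplex_props(5))
  then show "\<not> trivial_limit (at (s ! k) within open_simplex s)" by (simp add: trivial_limit_within)
  have "(f \<longlongrightarrow> f (s ! k)) (at (s ! k) within mesh_carrier M)"
    using f mesh_carrier_vertex[OF s, of k] h k by (auto simp: continuous_on_def)
  moreover have "open_simplex s \<subseteq> mesh_carrier M"
    unfolding mesh_carrier_eq using s open_simplex_props(6) by blast
  ultimately show "(f \<longlongrightarrow> f (s ! k)) (at (s ! k) within open_simplex s)"
    by (rule tendsto_within_subset)
qed

lemma lumped_prod_continuous:
  fixes M :: "(real ^ 'd) mesh" and u v :: "real ^ 'd \<Rightarrow> 'b::real_inner"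
  assumes M: "polyhedral_hypersurface M" and d: "CARD('d) \<ge> 2"
    and u: "continuous_on (mesh_carrier M) u" and v: "continuous_on (mesh_carrier M) v"
  shows "lumped_prod M u v = 1 / real CARD('d) * (\<Sum>s\<in>M. measure surface_measure (open_simplex s) *
        (\<Sum>k<CARD('d). u (s ! k) \<bullet> v (s ! k)))"
  unfolding lumped_prod_def
  by (intro arg_cong2[where f="(*)"] refl sum.cong Lim_at_vertex[OF M d])
    (auto intro!: continuous_on_inner u v)

section \<open>Nodal interpolation on conforming meshes\<close>

lemma affine_interpolation:
  fixes A :: "'a::euclidean_space set" and f :: "'a \<Rightarrow> real"
  assumes A: "\<not> affine_dependent A"
  obtains L c where "linear L" "\<And>q. q \<in> A \<Longrightarrow> L q + c = f q"
proof (cases "A = {}")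
  case True
  then show ?thesis using that[of "\<lambda>x. 0" 0] by (simp add: linear_zero)
next
  case False
  then obtain a where a: "a \<in> A" by blast
  \<comment> \<open>Moving the vertex \<open>a\<close> to 0 makes the other vertices linearly
    independent, so a linear map can be prescribed on them.\<close>
  let ?B = "(\<lambda>x. - a + x) ` (A - {a})"
  have "independent ?B" using A affine_dependent_iff_dependent2[OF a] by simp
  then obtain L where L: "linear L" "\<And>x. x \<in> ?B \<Longrightarrow> L x = f (a + x) - f a"
    using linear_independent_extend[of ?B "\<lambda>x. f (a + x) - f a"] by blast
  have "L q + (f a - L a) = f q" if "q \<in> A" for q
  proof (cases "q = a")
    case False
    then have "L (- a + q) = f q - f a" using L(2)[of "- a + q"] that by simp
    then show ?thesis by (simp add: linear_diff[OF L(1)])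
  qed simp
  then show ?thesis using that L(1) by blast
qed

text \<open>The set on which two affine maps agree is convex.\<close>

lemma affine_eq_on_convex_hull:
  fixes L L' :: "'a::real_vector \<Rightarrow> 'b::real_vector"
  assumes L: "linear L" "linear L'" and eq: "\<And>q. q \<in> A \<Longrightarrow> L q + c = L' q + c'"
    and x: "x \<in> convex hull A"
  shows "L x + c = L' x + c'"
proof -
  have "convex {x. L x - L' x \<in> {c' - c}}"
    using convex_linear_vimage[OF linear_compose_sub[OF L] convex_singleton[of "c' - c"]]
    by (simp add: vimage_def)
  then have "convex hull A \<subseteq> {x. L x - L' x \<in> {c' - c}}"
    by (rule hull_minimal[rotated]) (use eq in \<open>auto simp: algebra_simps\<close>)
  then show ?thesis using x by (auto simp: algebra_simps)
qed

text \<open>The intersection is a face of both simplices, hence the hull of some vertices of each.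
  The two vertex sets coincide, both being the extreme points of the intersection.\<close>

lemma triangulated_convex_hull_Int:
  fixes M :: "'a::euclidean_space list set"
  assumes tri: "triangulation ((\<lambda>s. convex hull set s) ` M)"
    and ind: "\<And>s. s \<in> M \<Longrightarrow> \<not> affine_dependent (set s)"
    and st: "s \<in> M" "t \<in> M"
  obtains a where "a \<subseteq> set s" "a \<subseteq> set t" "convex hull set s \<inter> convex hull set t = convex hull a"
proof -
  let ?I = "convex hull set s \<inter> convex hull set t"
  have f: "?I face_of convex hull set s" "convex hull set t \<inter> convex hull set s face_of convex hull set t"
    using tri st unfolding triangulation_def by blast+
  obtain a where a: "a \<subseteq> set s" "?I = convex hull a"
    using f(1) face_of_convex_hull_affine_independent[OF ind[OF st(1)]] by blast
  obtain b where b: "b \<subseteq> set t" "?I = convex hull b"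
    using f(2) face_of_convex_hull_affine_independent[OF ind[OF st(2)]] by (auto simp: Int_commute)
  have "\<not> affine_dependent a" "\<not> affine_dependent b"
    using a(1) b(1) ind st affine_dependent_subset by blast+
  then have "x \<in> a \<longleftrightarrow> x \<in> b" for x
    using extreme_point_of_convex_hull_affine_independent a(2) b(2) by metis
  then show ?thesis using that[of a] a b by blast
qed

text \<open>The affine interpolants of the simplices are glued. Two of them agree at the common
  vertices, hence on the whole common face; continuity follows because the closed simplices are
  finitely many.\<close>

lemma nodal_interp_exists:
  fixes M :: "(real ^ 'd) mesh"
  assumes M: "polyhedral_hypersurface M"
  shows "\<exists>v. v \<in> surface_space M \<and> (\<forall>q\<in>mesh_vertices M. v q = f q)"
proof -
  have tri: "triangulation ((\<lambda>s. convex hull set s) ` M)" and fin: "finite M"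
    using M by (auto simp: polyhedral_hypersurface_def)
  note ind = hypersurface_simplex(2)[OF M]
  have "\<forall>s\<in>M. \<exists>L c. linear L \<and> (\<forall>q\<in>set s. L q + c = f q)"
    using affine_interpolation[OF ind] by metis
  then obtain L c where L: "\<And>s. s \<in> M \<Longrightarrow> linear (L s)"
    "\<And>s q. s \<in> M \<Longrightarrow> q \<in> set s \<Longrightarrow> L s q + c s = f q" by metis
  \<comment> \<open>An arbitrary simplex containing \<open>x\<close>; the fact \<open>v\<close>
    below shows that the value does not depend on the choice.\<close>
  define pick where "pick x = (SOME s. s \<in> M \<and> x \<in> convex hull set s)" for x
  define v where "v x = L (pick x) x + c (pick x)" for x
  have v: "v x = L s x + c s" if s: "s \<in> M" "x \<in> convex hull set s" for x s
  proof -
    have p: "pick x \<in> M" "x \<in> convex hull set (pick x)"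
      unfolding pick_def using someI[of "\<lambda>s. s \<in> M \<and> x \<in> convex hull set s" s] s by auto
    obtain a where a: "a \<subseteq> set (pick x)" "a \<subseteq> set s"
      "convex hull set (pick x) \<inter> convex hull set s = convex hull a"
      using triangulated_convex_hull_Int[OF tri ind p(1) s(1)] by blast
    have "x \<in> convex hull a" using a(3) p s by blast
    then show ?thesis unfolding v_def
      by (rule affine_eq_on_convex_hull[OF L(1) L(1), OF p(1) s(1), rotated]) (metis L(2) a(1,2) p(1) s(1) subsetD)
  qed
  have "continuous_on (mesh_carrier M) v"
    unfolding mesh_carrier_eq
  proof (rule continuous_on_closed_Union[OF fin])
    fix s assume s: "s \<in> M"
    show "closed (convex hull set s)" by (simp add: compact_imp_closed finite_imp_compact_convex_hull)
    have "continuous_on (convex hull set s) (\<lambda>x. L s x + c s)"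
      using L(1)[OF s] by (intro continuous_intros linear_continuous_on) (simp add: linear_conv_bounded_linear)
    then show "continuous_on (convex hull set s) v" by (simp add: continuous_on_cong[OF refl v[OF s]])
  qed
  moreover have "affine_map_on (open_simplex s) v" if "s \<in> M" for s
    unfolding affine_map_on_def using L(1)[OF that] v[OF that] open_simplex_props(6) by blast
  moreover have "v q = f q" if q: "q \<in> mesh_vertices M" for q
  proof -
    obtain s where "s \<in> M" "q \<in> set s" using q by (auto simp: mesh_vertices_def)
    then show ?thesis using v[of s q] L(2) hull_inc[of q "set s"] by simp
  qed
  ultimately show ?thesis unfolding surface_space_def by blast
qed

lemma
  fixes M :: "(real ^ 'd) mesh"
  assumes "polyhedral_hypersurface M"
  shows nodal_interp_in_surface_space: "nodal_interp M f \<in> surface_space M"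
    and nodal_interp_vertex: "q \<in> mesh_vertices M \<Longrightarrow> nodal_interp M f q = f q"
  using someI_ex[OF nodal_interp_exists[OF assms, of f]] unfolding nodal_interp_def by blast+

section \<open>Surface gradients and area change on a whole mesh\<close>

lemma surface_vspace_continuous:
  assumes "X \<in> surface_vspace M"
  shows "continuous_on (mesh_carrier M) X"
proof -
  have "continuous_on (mesh_carrier M) (\<lambda>x. \<chi> c. X x $ c)"
    using assms by (intro continuous_on_vec_lambda) (auto simp: surface_vspace_def surface_space_def)
  then show ?thesis by simp
qed

lemma surface_vspace_diff_id:
  fixes X :: "real ^ 'd \<Rightarrow> real ^ 'd"
  assumes X: "X \<in> surface_vspace M"
  shows "(\<lambda>x. X x - x) \<in> surface_vspace M"
  unfolding surface_vspace_def surface_space_def mem_Collect_eq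
proof (intro allI conjI ballI)
  fix c
  show "continuous_on (mesh_carrier M) (\<lambda>x. (X x - x) $ c)"
    by (intro continuous_intros surface_vspace_continuous X)
  fix s assume "s \<in> M"
  then have "affine_map_on (open_simplex s) (\<lambda>x. X x $ c)"
    using X by (simp add: surface_vspace_def surface_space_def)
  then obtain L b where L: "linear L" "\<And>x. x \<in> open_simplex s \<Longrightarrow> X x $ c = L x + b"
    by (auto simp: affine_map_on_def)
  have "linear (\<lambda>x. L x - x $ c)"
    by (intro linear_compose_sub L bounded_linear.linear[OF bounded_linear_vec_nth])
  then show "affine_map_on (open_simplex s) (\<lambda>x. (X x - x) $ c)"
    unfolding affine_map_on_def
    by (intro exI[of _ "\<lambda>x. L x - x $ c"] exI[of _ b]) (simp add: L)
qed

text \<open>The two values of \<open>CARD('d)\<close> select 1 or 2 for \<open>'k\<close>, the sizes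
  for which the determinant bound is available.\<close>

lemma simplex_area_change_le:
  fixes M :: "(real ^ 'd) mesh"
  assumes d: "CARD('d) \<in> {2, 3}" and M: "polyhedral_hypersurface M" and s: "s \<in> M"
    and X: "X \<in> surface_vspace M"
  obtains G H where "tangential_slope (open_simplex s) X G" "tangential_slope (open_simplex s) id H"
    "emeasure (surface_measure :: (real ^ 'd) measure) (open_simplex s) < \<infinity>"
    "measure surface_measure (X ` open_simplex s) \<le>
       measure surface_measure (open_simplex s) * (1 + G \<bullet> (G - H))"
proof -
  note h = hypersurface_simplex[OF M s]
  have "s \<noteq> []" using h(1) zero_less_card_finite[where 'a='d] by (metis length_greater_0_conv)
  then have ne: "open_simplex s \<noteq> {}" by (rule open_simplex_props(8))
  have dim: "aff_dim (open_simplex s) = int CARD('d) - 1"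
    using aff_dim_affine_independent[OF h(2)] h(3) by (simp add: open_simplex_props(7))
  have aff: "affine_map_on (open_simplex s) (\<lambda>y. X y $ c)" for c
    using X s by (auto simp: surface_vspace_def surface_space_def)
  note change = area_change_le[OF open_simplex_props(1-3) ne _ _ _ aff]
  from d show ?thesis
  proof (elim insertE emptyE)
    assume "CARD('d) = 2"
    then show ?thesis using change[where 'k=1, OF _ _ abs_det_1_le] dim that by auto
  next
    assume "CARD('d) = 3"
    then show ?thesis using change[where 'k=2, OF _ _ abs_det_2_le] dim that by auto
  qed
qed

lemma surface_grad_slope:
  fixes M :: "(real ^ 'd) mesh"
  assumes M: "polyhedral_hypersurface M" and s: "s \<in> M" and x: "x \<in> open_simplex s"
    and G: "tangential_slope (open_simplex s) X G"
  shows "surface_grad M X x = G"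
proof -
  have fin: "finite M" and disj: "disjoint_family_on open_simplex M"
    using M by (auto simp: polyhedral_hypersurface_def)
  have "(\<Sum>t\<in>M. indicator (open_simplex t) x *\<^sub>R tangential_grad (open_simplex t) (\<lambda>y. X y $ c) x) = G $ c" for c
  proof -
    have "indicator (open_simplex t) x = (if t = s then 1 else 0 :: real)" if "t \<in> M" for t
      using disj that s x by (auto simp: indicator_def disjoint_family_on_def)
    then have "(\<Sum>t\<in>M. indicator (open_simplex t) x *\<^sub>R tangential_grad (open_simplex t) (\<lambda>y. X y $ c) x) =
        (\<Sum>t\<in>M. if t = s then tangential_grad (open_simplex t) (\<lambda>y. X y $ c) x else 0)"
      by (intro sum.cong) auto
    also have "\<dots> = tangential_grad (open_simplex s) (\<lambda>y. X y $ c) x" using fin s by simp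
    also have "\<dots> = G $ c" by (rule tangential_slope_tangential_grad[OF G open_simplex_props(2) x])
    finally show ?thesis .
  qed
  then show ?thesis by (simp add: surface_grad_def vec_eq_iff)
qed

text \<open>\<open>surface_grad\<close> vanishes off the open simplices by definition, so the
  integrand is exactly a finite combination of their indicators. Finite areas make it
  integrable.\<close>

lemma exact_prod_surface_grad:
  fixes M :: "(real ^ 'd) mesh"
  assumes M: "polyhedral_hypersurface M"
    and fin: "\<And>s. s \<in> M \<Longrightarrow> emeasure (surface_measure :: (real ^ 'd) measure) (open_simplex s) < \<infinity>"
    and G: "\<And>s. s \<in> M \<Longrightarrow> tangential_slope (open_simplex s) X (G s)"
    and H: "\<And>s. s \<in> M \<Longrightarrow> tangential_slope (open_simplex s) Y (H s)"
  shows "exact_prod M (surface_grad M X) (surface_grad M Y) =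
    (\<Sum>s\<in>M. measure surface_measure (open_simplex s) * (G s \<bullet> H s))"
proof -
  have finM: "finite M" and disj: "disjoint_family_on open_simplex M"
    using M by (auto simp: polyhedral_hypersurface_def)
  have integrand: "indicator (mesh_carrier M) x *\<^sub>R (surface_grad M X x \<bullet> surface_grad M Y x) =
      (\<Sum>s\<in>M. indicator (open_simplex s) x * (G s \<bullet> H s))" for x
  proof (cases "\<exists>s\<in>M. x \<in> open_simplex s")
    case True
    then obtain s where s: "s \<in> M" "x \<in> open_simplex s" by blast
    have "(\<Sum>t\<in>M. indicator (open_simplex t) x * (G t \<bullet> H t)) = (\<Sum>t\<in>M. if t = s then G t \<bullet> H t else 0)"
      using disj s by (intro sum.cong refl) (auto simp: indicator_def disjoint_family_on_def)
    moreover have "x \<in> mesh_carrier M"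
      unfolding mesh_carrier_eq using s open_simplex_props(6) by blast
    ultimately show ?thesis
      using finM s by (simp add: surface_grad_slope[OF M s G[OF s(1)]] surface_grad_slope[OF M s H[OF s(1)]])
  next
    case False
    then have "surface_grad M X x = 0" by (simp add: surface_grad_def vec_eq_iff indicator_def)
    moreover have "(\<Sum>s\<in>M. indicator (open_simplex s) x * (G s \<bullet> H s)) = 0"
      using False by (intro sum.neutral) (auto simp: indicator_def)
    ultimately show ?thesis by simp
  qed
  have "exact_prod M (surface_grad M X) (surface_grad M Y) =
      (LINT x|surface_measure. (\<Sum>s\<in>M. indicator (open_simplex s) x * (G s \<bullet> H s)))"
    unfolding exact_prod_def set_lebesgue_integral_def integrand ..
  also have "\<dots> = (\<Sum>s\<in>M. LINT x|surface_measure. indicator (open_simplex s) x * (G s \<bullet> H s))"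
    using fin by (intro Bochner_Integration.integral_sum integrable_mult_left integrable_real_indicator)
      (auto simp: open_simplex_props(4))
  also have "\<dots> = (\<Sum>s\<in>M. measure surface_measure (open_simplex s) * (G s \<bullet> H s))"
    by simp
  finally show ?thesis .
qed

text \<open>The bounds for the simplices are added. Since \<open>G s - H s\<close> is the slope of
  the displacement, the excess terms form the Dirichlet product of \<open>X\<close> with it.\<close>

lemma hypersurface_area_change_le:
  fixes M :: "(real ^ 'd) mesh"
  assumes d: "CARD('d) \<in> {2, 3}" and M: "polyhedral_hypersurface M" and X: "X \<in> surface_vspace M"
  shows "(\<Sum>s\<in>M. measure surface_measure (X ` open_simplex s)) \<le>
    (\<Sum>s\<in>M. measure surface_measure (open_simplex s)) +
    exact_prod M (surface_grad M X) (surface_grad M (\<lambda>x. X x - x))"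
proof -
  have "\<exists>G H. tangential_slope (open_simplex s) X G \<and> tangential_slope (open_simplex s) id H \<and>
    emeasure (surface_measure :: (real ^ 'd) measure) (open_simplex s) < \<infinity> \<and>
    measure surface_measure (X ` open_simplex s) \<le>
       measure surface_measure (open_simplex s) * (1 + G \<bullet> (G - H))" if "s \<in> M" for s
    using simplex_area_change_le[OF d M that X] by metis
  then obtain G H where G: "\<And>s. s \<in> M \<Longrightarrow> tangential_slope (open_simplex s) X (G s)"
    and H: "\<And>s. s \<in> M \<Longrightarrow> tangential_slope (open_simplex s) id (H s)"
    and fin: "\<And>s. s \<in> M \<Longrightarrow> emeasure (surface_measure :: (real ^ 'd) measure) (open_simplex s) < \<infinity>"
    and le: "\<And>s. s \<in> M \<Longrightarrow> measure surface_measure (X ` open_simplex s) \<le>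
       measure surface_measure (open_simplex s) * (1 + G s \<bullet> (G s - H s))"
    by metis
  have "(\<Sum>s\<in>M. measure surface_measure (X ` open_simplex s)) \<le>
      (\<Sum>s\<in>M. measure surface_measure (open_simplex s) * (1 + G s \<bullet> (G s - H s)))"
    by (intro sum_mono le)
  also have "\<dots> = (\<Sum>s\<in>M. measure surface_measure (open_simplex s)) +
      (\<Sum>s\<in>M. measure surface_measure (open_simplex s) * (G s \<bullet> (G s - H s)))"
    by (simp add: distrib_left sum.distrib)
  also have "(\<Sum>s\<in>M. measure surface_measure (open_simplex s) * (G s \<bullet> (G s - H s))) =
      exact_prod M (surface_grad M X) (surface_grad M (\<lambda>x. X x - x))"
    by (rule exact_prod_surface_grad[OF M fin G, symmetric])
      (use tangential_slope_diff[OF G H] in simp_all)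
  finally show ?thesis .
qed

lemma quad_prod_commute: "quad_prod h M u v = quad_prod h M v u"
  by (cases h) (simp_all add: lumped_prod_def exact_prod_def inner_commute)

section \<open>Stability of the scheme\<close>

theorem theorem4p2:
  fixes \<Omega> :: "(real ^ 'd) set" and \<T> :: "(real ^ 'd) set set"
    and e :: "nat \<Rightarrow> 'd"
    and I_R I_S I_T :: nat
    and \<sigma> \<beta> :: "nat \<Rightarrow> real"
    and bp bm :: "nat \<Rightarrow> nat"
    and t :: "nat \<Rightarrow> real" and M m :: nat and T \<tau> :: real
    and s :: "nat \<Rightarrow> nat \<Rightarrow> nat"
    and J :: "nat \<Rightarrow> (real ^ 'd) set set"
    and \<Gamma> :: "nat \<Rightarrow> (real ^ 'd) mesh"
    and \<omega> :: "nat \<Rightarrow> real ^ 'd \<Rightarrow> real ^ 'd"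
    and h :: quadrature
    and W :: "real ^ 'd \<Rightarrow> real"
    and X :: "nat \<Rightarrow> real ^ 'd \<Rightarrow> real ^ 'd"
    and \<kappa> :: "nat \<Rightarrow> real ^ 'd \<Rightarrow> real"
  assumes dim: "CARD('d) \<in> {2, 3}"
    and coords: "bij_betw e {1..CARD('d)} UNIV"
    and domain: "open \<Omega>" "connected \<Omega>" "\<Omega> \<noteq> {}" "bounded \<Omega>"
    and bulk_mesh: "triangulation \<T>" "\<And>K. K \<in> \<T> \<Longrightarrow> int CARD('d) simplex K" "\<Union>\<T> = closure \<Omega>"
    and counts: "I_R \<ge> 2" "I_S \<ge> 1"
    and tension: "\<And>i. i \<in> {1..I_S} \<Longrightarrow> \<sigma> i > 0"
    and beta: "inj_on \<beta> {1..I_R}" "(\<Sum>l=1..I_R. \<beta> l) = 0"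
    and phases: "\<And>i. i \<in> {1..I_S} \<Longrightarrow> bp i \<in> {1..I_R} \<and> bm i \<in> {1..I_R} \<and> bp i \<noteq> bm i"
      "\<And>i j. i \<in> {1..I_S} \<Longrightarrow> j \<in> {1..I_S} \<Longrightarrow> {bp i, bm i} = {bp j, bm j} \<Longrightarrow>
         (bp i, bm i) = (bp j, bm j)"
    and time_grid: "t 0 = 0" "\<And>n. n < M \<Longrightarrow> t n < t (Suc n)" "t M = T" "m < M"
      "\<tau> = t (Suc m) - t m"
    and cluster: "surface_cluster I_S I_T s J \<Gamma>"
      "\<And>i. i \<in> {1..I_S} \<Longrightarrow> mesh_carrier (\<Gamma> i) \<subseteq> closure \<Omega>"
    and vertex_normal: "\<And>i. i \<in> {1..I_S} \<Longrightarrow> is_vertex_normal e (\<Gamma> i) (\<omega> i)"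
    and spaces: "W \<in> bulk_space \<Omega> \<T>" "X \<in> cluster_vspace I_S I_T s J \<Gamma>" "\<kappa> \<in> cluster_space I_S \<Gamma>"
    and a: "\<And>\<phi>. \<phi> \<in> bulk_space \<Omega> \<T> \<Longrightarrow>
      (LINT x:\<Omega>|lebesgue. grad W x \<bullet> grad \<phi> x)
      + (\<Sum>i=1..I_S. (\<beta> (bp i) - \<beta> (bm i)) *
           quad_prod h (\<Gamma> i) (nodal_interp (\<Gamma> i) (\<lambda>x. ((X i x - x) /\<^sub>R \<tau>) \<bullet> \<omega> i x)) \<phi>) = 0"
    and b: "\<And>\<xi>. \<xi> \<in> cluster_space I_S \<Gamma> \<Longrightarrow>
      (\<Sum>i=1..I_S. lumped_prod (\<Gamma> i) (\<kappa> i) (\<xi> i))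
      + (\<Sum>i=1..I_S. (\<beta> (bp i) - \<beta> (bm i)) * quad_prod h (\<Gamma> i) W (\<xi> i)) = 0"
    and c: "\<And>\<eta>. \<eta> \<in> cluster_vspace I_S I_T s J \<Gamma> \<Longrightarrow>
      (\<Sum>i=1..I_S. lumped_prod (\<Gamma> i) (\<lambda>x. \<kappa> i x *\<^sub>R \<omega> i x) (\<eta> i))
      + (\<Sum>i=1..I_S. \<sigma> i *
           exact_prod (\<Gamma> i) (surface_grad (\<Gamma> i) (X i)) (surface_grad (\<Gamma> i) (\<eta> i))) = 0"
  shows "cluster_energy I_S \<sigma> \<Gamma> X + \<tau> * (LINT x:\<Omega>|lebesgue. (norm (grad W x))\<^sup>2)
           \<le> cluster_energy I_S \<sigma> \<Gamma> (\<lambda>i. id)"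
proof -
  have d: "CARD('d) \<ge> 2" using dim by auto
  have \<tau>: "\<tau> > 0" using time_grid by simp
  have \<Gamma>: "polyhedral_hypersurface (\<Gamma> i)" if "i \<in> {1..I_S}" for i
    using cluster(1) that by (simp add: surface_cluster_def)
  have X: "X i \<in> surface_vspace (\<Gamma> i)" if "i \<in> {1..I_S}" for i
    using spaces(2) that by (simp add: cluster_vspace_def)
  define f where "f i x = ((X i x - x) /\<^sub>R \<tau>) \<bullet> \<omega> i x" for i x
  \<comment> \<open>The interpolated normal velocity from (a) is itself admissible in (b). Symmetry
    of the product then makes the coupling terms coincide, with either quadrature.\<close>
  define \<nu> where "\<nu> i = nodal_interp (\<Gamma> i) (f i)" for i
  have \<nu>: "\<nu> i \<in> surface_space (\<Gamma> i)" if "i \<in> {1..I_S}" for i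
    unfolding \<nu>_def by (rule nodal_interp_in_surface_space[OF \<Gamma>[OF that]])
  define D where "D = (LINT x:\<Omega>|lebesgue. (norm (grad W x))\<^sup>2)"
  define Q where "Q i = (\<beta> (bp i) - \<beta> (bm i)) * quad_prod h (\<Gamma> i) W (\<nu> i)" for i
  have "D + (\<Sum>i=1..I_S. Q i) = 0"
    using a[OF spaces(1), folded f_def, folded \<nu>_def]
    by (simp add: D_def Q_def power2_norm_eq_inner quad_prod_commute[of h _ W])
  moreover have "\<nu> \<in> cluster_space I_S \<Gamma>"
    using \<nu> by (simp add: cluster_space_def)
  then have "(\<Sum>i=1..I_S. lumped_prod (\<Gamma> i) (\<kappa> i) (\<nu> i)) + (\<Sum>i=1..I_S. Q i) = 0"
    unfolding Q_def by (rule b)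
  ultimately have D: "D = (\<Sum>i=1..I_S. lumped_prod (\<Gamma> i) (\<kappa> i) (\<nu> i))" by simp
  \<comment> \<open>All functions involved are continuous, so only vertex values enter, and there
    the interpolant \<open>\<nu> i\<close> equals \<open>f i\<close>. Multiplying by
    \<open>\<tau> > 0\<close> undoes the division in \<open>f\<close>.\<close>
  have lumped: "lumped_prod (\<Gamma> i) (\<lambda>x. \<kappa> i x *\<^sub>R \<omega> i x) (\<lambda>x. X i x - x) =
      \<tau> * lumped_prod (\<Gamma> i) (\<kappa> i) (\<nu> i)" if i: "i \<in> {1..I_S}" for i
  proof -
    have "\<omega> i \<in> surface_vspace (\<Gamma> i)" using vertex_normal[OF i] by (simp add: is_vertex_normal_def)
    then have \<omega>: "continuous_on (mesh_carrier (\<Gamma> i)) (\<omega> i)" by (rule surface_vspace_continuous)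
    have \<kappa>: "continuous_on (mesh_carrier (\<Gamma> i)) (\<kappa> i)"
      using spaces(3) i by (simp add: cluster_space_def surface_space_def)
    have cont\<nu>: "continuous_on (mesh_carrier (\<Gamma> i)) (\<nu> i)"
      using \<nu>[OF i] by (simp add: surface_space_def)
    note lump = lumped_prod_continuous[OF \<Gamma>[OF i] d]
    have "(\<kappa> i q *\<^sub>R \<omega> i q) \<bullet> (X i q - q) = \<tau> * (\<kappa> i q \<bullet> \<nu> i q)"
      if "q \<in> mesh_vertices (\<Gamma> i)" for q
      using nodal_interp_vertex[OF \<Gamma>[OF i] that, of "f i"] \<tau>
      by (simp add: \<nu>_def f_def inner_commute)
    moreover have "s ! k \<in> mesh_vertices (\<Gamma> i)" if "s \<in> \<Gamma> i" "k < CARD('d)" for s k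
      using that hypersurface_simplex(1)[OF \<Gamma>[OF i]] by (force simp: mesh_vertices_def)
    ultimately have vertex_sum: "(\<Sum>k<CARD('d). (\<kappa> i (s ! k) *\<^sub>R \<omega> i (s ! k)) \<bullet> (X i (s ! k) - s ! k)) =
        \<tau> * (\<Sum>k<CARD('d). \<kappa> i (s ! k) \<bullet> \<nu> i (s ! k))" if "s \<in> \<Gamma> i" for s
      unfolding sum_distrib_left using that by (intro sum.cong) auto
    have "(\<Sum>s\<in>\<Gamma> i. measure surface_measure (open_simplex s) *
          (\<Sum>k<CARD('d). (\<kappa> i (s ! k) *\<^sub>R \<omega> i (s ! k)) \<bullet> (X i (s ! k) - s ! k))) =
        \<tau> * (\<Sum>s\<in>\<Gamma> i. measure surface_measure (open_simplex s) *
          (\<Sum>k<CARD('d). \<kappa> i (s ! k) \<bullet> \<nu> i (s ! k)))"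
      unfolding sum_distrib_left[of \<tau> _ "\<Gamma> i"]
      by (intro sum.cong refl) (simp only: vertex_sum mult.left_commute)
    then show ?thesis
      unfolding lump[OF continuous_on_scaleR[OF \<kappa> \<omega>] surface_vspace_continuous[OF surface_vspace_diff_id[OF X[OF i]]]]
        lump[OF \<kappa> cont\<nu>]
      by simp
  qed
  let ?\<eta> = "\<lambda>i x. X i x - x"
  let ?P = "\<lambda>i. exact_prod (\<Gamma> i) (surface_grad (\<Gamma> i) (X i)) (surface_grad (\<Gamma> i) (?\<eta> i))"
  \<comment> \<open>The displacement still matches at the junctions, because the same identity is
    subtracted on all three surfaces.\<close>
  have "?\<eta> \<in> cluster_vspace I_S I_T s J \<Gamma>"
    using spaces(2) surface_vspace_diff_id by (auto simp: cluster_vspace_def)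
  from c[OF this] have "(\<Sum>i=1..I_S. \<tau> * lumped_prod (\<Gamma> i) (\<kappa> i) (\<nu> i)) + (\<Sum>i=1..I_S. \<sigma> i * ?P i) = 0"
    by (simp only: lumped cong: sum.cong)
  then have "\<tau> * D + (\<Sum>i=1..I_S. \<sigma> i * ?P i) = 0"
    by (simp add: D sum_distrib_left)
  \<comment> \<open>Positive surface tensions allow the area bounds to be weighted and
    added.\<close>
  moreover have "cluster_energy I_S \<sigma> \<Gamma> X \<le> cluster_energy I_S \<sigma> \<Gamma> (\<lambda>i. id) + (\<Sum>i=1..I_S. \<sigma> i * ?P i)"
    unfolding cluster_energy_def sum.distrib[symmetric] distrib_left[symmetric] image_id id_apply
    by (intro sum_mono mult_left_mono hypersurface_area_change_le dim \<Gamma> X) (auto intro: less_imp_le[OF tension])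
  ultimately show ?thesis unfolding D_def by linarith
qed

end
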